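(* Let $D^-$ be the additive code defined in the context. Its monomial automorphism group (the group of monomial transformations of $\mathbb{F}_4^{11}$ mapping $D^-$ onto itself) has order $54=2\cdot3^3$; its induced action on the $33$ vectors of weight $1$, numbered $1,\dots,33$ in the order $(1,0,\dots,0),(\omega,0,\dots,0),(\omega^2,0,\dots,0),(0,1,0,\dots,0),\dots,(0,\dots,0,\omega^2)$, is the subgroup of $S_{33}$ generated by $(1\,4\,27\,29\,14\,18)(2\,5\,25\,30\,15\,16)(3\,6\,26\,28\,13\,17)(7\,9\,8)(10\,22\,12\,24\,11\,23)(19\,31\,20\,32\,21\,33)$ and $(4\,32)(5\,33)(6\,31)(7\,17)(8\,18)(9\,16)(10\,23)(11\,24)(12\,22)(13\,27)(14\,25)(15\,26)(19\,28)(20\,29)(21\,30)$. The complete automorphism group of $D^-$ is the product of the monomial automorphism group with the group of translations by codewords of $D^-$, and has order $54\cdot 2^{12}$.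
   Context: $\mathbb{F}_4=\{0,1,\omega,\omega^2\}$ with $\omega^2=\omega+1$. A monomial transformation of $\mathbb{F}_4^n$ is the composition of a coordinate permutation with multiplication of each coordinate by a nonzero scalar (possibly depending on the coordinate). The complete automorphism group of a code $C\subseteq\mathbb{F}_4^n$ is its stabilizer in the group of all isometries of the Hamming space $\mathbb{F}_4^n$. $D^-$ is the $\mathbb{F}_2$-span of the following $12$ vectors of $\mathbb{F}_4^{11}$: $(0,0,0,0,0,\omega^2,\omega^2,0,\omega,1,\omega)$, $(0,0,0,0,0,\omega,0,\omega,\omega,\omega,1)$, $(1,0,0,0,0,1,0,1,\omega^2,\omega^2,1)$, $(\omega,0,0,0,0,0,\omega,1,\omega,\omega,\omega)$, $(0,1,0,0,0,0,1,1,1,\omega^2,\omega^2)$, $(0,\omega,0,0,0,\omega^2,1,\omega^2,\omega,\omega,0)$, $(0,0,1,0,0,\omega,\omega,1,1,0,1)$, $(0,0,\omega,0,0,\omega,1,\omega,\omega^2,\omega^2,0)$, $(0,0,0,1,0,\omega,\omega,\omega,0,1,\omega)$, $(0,0,0,\omega,0,\omega^2,1,1,\omega^2,0,\omega)$, $(0,0,0,0,1,\omega^2,\omega^2,\omega^2,1,0,\omega^2)$, $(0,0,0,0,\omega,\omega,1,0,1,\omega,\omega)$. *)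

theory Defs
  imports
    "HOL-Analysis.Cartesian_Space"
    "HOL-Library.Z2"
    "HOL-Number_Theory.Cong"
    "HOL-Algebra.Bij"
    "HOL-Algebra.Sym_Groups"
begin

section \<open>The field of four elements\<close>

datatype gf4 = F4_0 | F4_1 | F4_\<omega> | F4_\<omega>2

lemma UNIV_gf4: "UNIV = {F4_0, F4_1, F4_\<omega>, F4_\<omega>2}"
  using gf4.exhaust by blast

instance gf4 :: finite
  by standard (simp add: UNIV_gf4)

lemma CARD_gf4 [simp]: "CARD(gf4) = 4"
  by (simp add: UNIV_gf4)

instantiation gf4 :: field
begin

definition zero_gf4 :: gf4 where "0 = F4_0"

definition one_gf4 :: gf4 where "1 = F4_1"

fun plus_gf4 :: "gf4 \<Rightarrow> gf4 \<Rightarrow> gf4" where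
  "F4_0 + y = y"
| "x + F4_0 = x"
| "F4_1 + F4_1 = F4_0"
| "F4_1 + F4_\<omega> = F4_\<omega>2"
| "F4_1 + F4_\<omega>2 = F4_\<omega>"
| "F4_\<omega> + F4_1 = F4_\<omega>2"
| "F4_\<omega> + F4_\<omega> = F4_0"
| "F4_\<omega> + F4_\<omega>2 = F4_1"
| "F4_\<omega>2 + F4_1 = F4_\<omega>"
| "F4_\<omega>2 + F4_\<omega> = F4_1"
| "F4_\<omega>2 + F4_\<omega>2 = F4_0"

fun times_gf4 :: "gf4 \<Rightarrow> gf4 \<Rightarrow> gf4" where
  "F4_0 * y = F4_0"
| "x * F4_0 = F4_0"
| "F4_1 * y = y"
| "x * F4_1 = x"
| "F4_\<omega> * F4_\<omega> = F4_\<omega>2"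
| "F4_\<omega> * F4_\<omega>2 = F4_1"
| "F4_\<omega>2 * F4_\<omega> = F4_1"
| "F4_\<omega>2 * F4_\<omega>2 = F4_\<omega>"

definition uminus_gf4 :: "gf4 \<Rightarrow> gf4" where "- x = (x::gf4)"

definition minus_gf4 :: "gf4 \<Rightarrow> gf4 \<Rightarrow> gf4" where "x - y = x + (y::gf4)"

definition inverse_gf4 :: "gf4 \<Rightarrow> gf4" where "inverse x = x * (x::gf4)"

definition divide_gf4 :: "gf4 \<Rightarrow> gf4 \<Rightarrow> gf4" where "x div y = x * inverse (y::gf4)"

instance
proof
  fix a b c :: gf4
  show "a * b * c = a * (b * c)" by (cases a; cases b; cases c) simp_all
  show "a * b = b * a" by (cases a; cases b) simp_all
  show "1 * a = a" by (cases a) (simp_all add: one_gf4_def)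
  show "a + b + c = a + (b + c)" by (cases a; cases b; cases c) simp_all
  show "a + b = b + a" by (cases a; cases b) simp_all
  show "0 + a = a" by (simp add: zero_gf4_def)
  show "- a + a = 0" by (cases a) (simp_all add: uminus_gf4_def zero_gf4_def)
  show "a - b = a + - b" by (simp add: minus_gf4_def uminus_gf4_def)
  show "(a + b) * c = a * c + b * c" by (cases a; cases b; cases c) simp_all
  show "(0::gf4) \<noteq> 1" by (simp add: zero_gf4_def one_gf4_def)
  show "a \<noteq> 0 \<Longrightarrow> inverse a * a = 1"
    by (cases a) (simp_all add: inverse_gf4_def zero_gf4_def one_gf4_def)
  show "a div b = a * inverse b" by (simp add: divide_gf4_def)
  show "inverse (0::gf4) = 0" by (simp add: inverse_gf4_def zero_gf4_def)
qed

end

definition \<omega> :: gf4 where "\<omega> = F4_\<omega>"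

lemma \<omega>_squared: "\<omega>\<^sup>2 = \<omega> + 1"
  by (simp add: \<omega>_def power2_eq_square one_gf4_def)

lemma \<omega>_squared_eq: "\<omega>\<^sup>2 = F4_\<omega>2"
  by (simp add: \<omega>_def power2_eq_square)

lemma UNIV_gf4_\<omega>: "UNIV = {0, 1, \<omega>, \<omega>\<^sup>2}"
  unfolding UNIV_gf4 \<omega>_squared_eq by (simp add: \<omega>_def zero_gf4_def one_gf4_def)


section \<open>Isometries, monomial transformations and automorphism groups\<close>

definition hamming_dist :: "'a ^ 'n \<Rightarrow> 'a ^ 'n \<Rightarrow> nat" where
  "hamming_dist x y = card {i. x $ i \<noteq> y $ i}"

definition hamming_isometry_group :: "('a ^ 'n \<Rightarrow> 'a ^ 'n) monoid" where
  "hamming_isometry_group =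
     BijGroup UNIV \<lparr>carrier := {f. bij f \<and> (\<forall>x y. hamming_dist (f x) (f y) = hamming_dist x y)}\<rparr>"

definition monomial :: "('a::field ^ 'n \<Rightarrow> 'a ^ 'n) \<Rightarrow> bool" where
  "monomial f \<longleftrightarrow>
     (\<exists>\<pi> a. bij \<pi> \<and> (\<forall>i. a i \<noteq> 0) \<and> f = (\<lambda>x. \<chi> i. a i * x $ \<pi> i))"

definition complete_aut_group :: "('a ^ 'n) set \<Rightarrow> ('a ^ 'n \<Rightarrow> 'a ^ 'n) monoid" where
  "complete_aut_group C =
     hamming_isometry_group \<lparr>carrier := {f \<in> carrier hamming_isometry_group. f ` C = C}\<rparr>"

definition monomial_aut_group :: "('a::field ^ 'n) set \<Rightarrow> ('a ^ 'n \<Rightarrow> 'a ^ 'n) monoid" where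
  "monomial_aut_group C = hamming_isometry_group \<lparr>carrier := {f. monomial f \<and> f ` C = C}\<rparr>"

definition translation_group :: "('a::field ^ 'n) set \<Rightarrow> ('a ^ 'n \<Rightarrow> 'a ^ 'n) monoid" where
  "translation_group C = hamming_isometry_group \<lparr>carrier := (\<lambda>c x. x + c) ` C\<rparr>"

lemma Bij_UNIV: "Bij UNIV = {f. bij f}"
  by (simp add: Bij_def)

lemma carrier_hamming_isometry_group:
  "f \<in> carrier hamming_isometry_group \<longleftrightarrow>
     bij f \<and> (\<forall>x y. hamming_dist (f x) (f y) = hamming_dist x y)"
  by (simp add: hamming_isometry_group_def)

lemma mult_hamming_isometry_group:
  "bij f \<Longrightarrow> bij g \<Longrightarrow> f \<otimes>\<^bsub>hamming_isometry_group\<^esub> g = f \<circ> g"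
  by (simp add: hamming_isometry_group_def BijGroup_def Bij_UNIV compose_def fun_eq_iff)

lemma one_hamming_isometry_group: "\<one>\<^bsub>hamming_isometry_group\<^esub> = id"
  by (simp add: hamming_isometry_group_def BijGroup_def fun_eq_iff)

lemma group_hamming_isometry_group: "group hamming_isometry_group"
proof (rule groupI)
  fix f g h :: "'a ^ 'n \<Rightarrow> 'a ^ 'n"
  assume f: "f \<in> carrier hamming_isometry_group"
  show "\<one>\<^bsub>hamming_isometry_group\<^esub> \<otimes>\<^bsub>hamming_isometry_group\<^esub> f = f"
    using f by (simp add: carrier_hamming_isometry_group mult_hamming_isometry_group
        one_hamming_isometry_group)
  have "inv' f \<in> carrier hamming_isometry_group"
  proof -
    have "hamming_dist (inv' f x) (inv' f y) = hamming_dist x y" for x y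
    proof -
      have "hamming_dist (inv' f x) (inv' f y) = hamming_dist (f (inv' f x)) (f (inv' f y))"
        using f by (simp add: carrier_hamming_isometry_group)
      then show ?thesis
        using f by (simp add: carrier_hamming_isometry_group bij_is_surj surj_f_inv_f)
    qed
    then show ?thesis
      using f by (simp add: carrier_hamming_isometry_group bij_imp_bij_inv)
  qed
  moreover have "inv' f \<otimes>\<^bsub>hamming_isometry_group\<^esub> f = \<one>\<^bsub>hamming_isometry_group\<^esub>"
    using f by (simp add: carrier_hamming_isometry_group mult_hamming_isometry_group
        one_hamming_isometry_group bij_imp_bij_inv bij_is_inj)
  ultimately show "\<exists>g\<in>carrier hamming_isometry_group.
      g \<otimes>\<^bsub>hamming_isometry_group\<^esub> f = \<one>\<^bsub>hamming_isometry_group\<^esub>" by blast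
  assume g: "g \<in> carrier hamming_isometry_group"
  show "f \<otimes>\<^bsub>hamming_isometry_group\<^esub> g \<in> carrier hamming_isometry_group"
    using f g by (simp add: carrier_hamming_isometry_group mult_hamming_isometry_group bij_comp)
  assume h: "h \<in> carrier hamming_isometry_group"
  show "f \<otimes>\<^bsub>hamming_isometry_group\<^esub> g \<otimes>\<^bsub>hamming_isometry_group\<^esub> h =
        f \<otimes>\<^bsub>hamming_isometry_group\<^esub> (g \<otimes>\<^bsub>hamming_isometry_group\<^esub> h)"
    using f g h by (simp add: carrier_hamming_isometry_group mult_hamming_isometry_group
        bij_comp comp_assoc)
qed (simp add: carrier_hamming_isometry_group one_hamming_isometry_group)

lemma monomial_imp_isometry:
  assumes "monomial f"
  shows "f \<in> carrier hamming_isometry_group"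
proof -
  obtain \<pi> a where \<pi>: "bij \<pi>" and a: "\<And>i. a i \<noteq> 0" and f: "f = (\<lambda>x. \<chi> i. a i * x $ \<pi> i)"
    using assms unfolding monomial_def by blast
  have "f ((\<chi> j. y $ (inv' \<pi> j) / a (inv' \<pi> j))) = y" for y
    using \<pi> a by (simp add: f vec_eq_iff bij_is_inj)
  moreover have "inj f"
  proof (rule injI)
    fix x y assume "f x = f y"
    then have "x $ \<pi> i = y $ \<pi> i" for i
      using a by (simp add: f vec_eq_iff)
    from this[of "inv' \<pi> j" for j] show "x = y"
      using \<pi> by (simp add: vec_eq_iff bij_is_surj surj_f_inv_f)
  qed
  ultimately have "bij f"
    by (intro bijI surjI)
  moreover have "hamming_dist (f x) (f y) = hamming_dist x y" for x y
  proof -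
    have "bij_betw \<pi> {i. f x $ i \<noteq> f y $ i} {i. x $ i \<noteq> y $ i}"
    proof (rule bij_betw_imageI)
      show "inj_on \<pi> {i. f x $ i \<noteq> f y $ i}"
        using \<pi> by (meson bij_is_inj inj_on_subset subset_UNIV)
      show "\<pi> ` {i. f x $ i \<noteq> f y $ i} = {i. x $ i \<noteq> y $ i}"
      proof (intro equalityI subsetI)
        fix j assume "j \<in> {i. x $ i \<noteq> y $ i}"
        then have "\<pi> (inv' \<pi> j) = j" "inv' \<pi> j \<in> {i. f x $ i \<noteq> f y $ i}"
          using \<pi> a by (simp_all add: f bij_is_surj surj_f_inv_f)
        then show "j \<in> \<pi> ` {i. f x $ i \<noteq> f y $ i}"
          by (metis imageI)
      qed (use a in \<open>auto simp: f\<close>)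
    qed
    then show ?thesis
      unfolding hamming_dist_def by (rule bij_betw_same_card)
  qed
  ultimately show ?thesis
    by (simp add: carrier_hamming_isometry_group)
qed

section \<open>The code\<close>

text \<open>
  \<open>bit\<close> is the two-element field, acting on \<open>gf4 ^ 'n\<close> through its embedding into \<open>gf4\<close>.
\<close>

definition f2_scale :: "bit \<Rightarrow> gf4 ^ 'n \<Rightarrow> gf4 ^ 'n" where
  "f2_scale b v = of_bool (b = 1) *s v"

lemma vector_space_f2_scale: "vector_space f2_scale"
proof
  fix a b :: bit and x y :: "gf4 ^ 'n"
  have two: "c + c = 0" for c :: gf4
    by (cases c) (simp_all add: zero_gf4_def)
  show "f2_scale a (x + y) = f2_scale a x + f2_scale a y"
    by (simp add: f2_scale_def vector_add_ldistrib)
  show "f2_scale (a + b) x = f2_scale a x + f2_scale b x"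
    unfolding f2_scale_def vec_eq_iff
    by (cases a; cases b) (simp_all only: two vector_smult_component vector_add_component, simp_all)
  show "f2_scale a (f2_scale b x) = f2_scale (a * b) x"
    by (cases a; cases b) (simp_all add: f2_scale_def)
  show "f2_scale 1 x = x"
    by (simp add: f2_scale_def)
qed

definition f2_span :: "(gf4 ^ 'n) set \<Rightarrow> (gf4 ^ 'n) set" where
  "f2_span = module.span f2_scale"

text \<open>
  Coordinates are numbered by \<open>1, \<dots>, 11\<close> in the index type \<open>11\<close> (where \<open>11 = 0\<close>), as
  \<open>vector\<close> does.
\<close>

definition D_minus :: "(gf4 ^ 11) set" where
  "D_minus = f2_span
    {vector [0,0,0,0,0,\<omega>\<^sup>2,\<omega>\<^sup>2,0,\<omega>,1,\<omega>],
     vector [0,0,0,0,0,\<omega>,0,\<omega>,\<omega>,\<omega>,1],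
     vector [1,0,0,0,0,1,0,1,\<omega>\<^sup>2,\<omega>\<^sup>2,1],
     vector [\<omega>,0,0,0,0,0,\<omega>,1,\<omega>,\<omega>,\<omega>],
     vector [0,1,0,0,0,0,1,1,1,\<omega>\<^sup>2,\<omega>\<^sup>2],
     vector [0,\<omega>,0,0,0,\<omega>\<^sup>2,1,\<omega>\<^sup>2,\<omega>,\<omega>,0],
     vector [0,0,1,0,0,\<omega>,\<omega>,1,1,0,1],
     vector [0,0,\<omega>,0,0,\<omega>,1,\<omega>,\<omega>\<^sup>2,\<omega>\<^sup>2,0],
     vector [0,0,0,1,0,\<omega>,\<omega>,\<omega>,0,1,\<omega>],
     vector [0,0,0,\<omega>,0,\<omega>\<^sup>2,1,1,\<omega>\<^sup>2,0,\<omega>],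
     vector [0,0,0,0,1,\<omega>\<^sup>2,\<omega>\<^sup>2,\<omega>\<^sup>2,1,0,\<omega>\<^sup>2],
     vector [0,0,0,0,\<omega>,\<omega>,1,0,1,\<omega>,\<omega>]}"

definition weight1_vector :: "nat \<Rightarrow> gf4 ^ 11" where
  "weight1_vector k = axis (of_nat ((k - 1) div 3 + 1)) ([1, \<omega>, \<omega>\<^sup>2] ! ((k - 1) mod 3))"

lemma bij_betw_weight1_vector:
  "bij_betw weight1_vector {1..33} {v. hamming_dist v 0 = 1}"
proof (rule bij_betw_imageI)
  let ?c = "\<lambda>k::nat. [1, \<omega>, \<omega>\<^sup>2] ! ((k - 1) mod 3)"
  let ?i = "\<lambda>k::nat. of_nat ((k - 1) div 3 + 1) :: 11"
  have lists: "[1, \<omega>, \<omega>\<^sup>2] ! m \<noteq> 0" if "m < 3" for m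
    using that unfolding \<omega>_squared_eq
    by (auto simp: less_Suc_eq numeral_3_eq_3 zero_gf4_def one_gf4_def \<omega>_def)
  have dist: "distinct [1, \<omega>, \<omega>\<^sup>2]"
    unfolding \<omega>_squared_eq by (simp add: one_gf4_def \<omega>_def)
  have axis_inj: "i = j \<and> c = d" if "axis i c = axis j d" "c \<noteq> 0" for i j :: 11 and c d :: gf4
  proof -
    have "axis i c $ k = axis j d $ k" for k
      using that by simp
    from this[of i] show ?thesis
      using that(2) by (auto simp: axis_def split: if_splits)
  qed
  have idx_inj: "m = m'" if "of_nat (m + 1) = (of_nat (m' + 1) :: 11)" "m < 11" "m' < 11" for m m'
  proof -
    have "[m + 1 = m' + 1] (mod 11)"
      using that(1) of_nat_eq_iff_cong_CHAR[of "m + 1" "m' + 1", where 'a = 11]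
      by (simp del: of_nat_add of_nat_Suc)
    then have "[m = m'] (mod 11)"
      by (simp only: cong_add_rcancel_nat)
    then show ?thesis
      using that(2,3) by (simp add: cong_def)
  qed
  show "inj_on weight1_vector {1..33}"
  proof (rule inj_onI)
    fix k l :: nat
    assume k: "k \<in> {1..33}" and l: "l \<in> {1..33}" and eq: "weight1_vector k = weight1_vector l"
    have "?i k = ?i l" "?c k = ?c l"
      using axis_inj[OF eq[unfolded weight1_vector_def]] lists by auto
    moreover have "(k - 1) div 3 < 11" "(l - 1) div 3 < 11"
      using k l by auto
    ultimately have "(k - 1) div 3 = (l - 1) div 3"
      using idx_inj by blast
    moreover have "(k - 1) mod 3 = (l - 1) mod 3"
      using \<open>?c k = ?c l\<close> nth_eq_iff_index_eq[OF dist] by auto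
    ultimately have "k - 1 = l - 1"
      by (metis div_mult_mod_eq)
    then show "k = l"
      using k l by auto
  qed
  show "weight1_vector ` {1..33} = {v. hamming_dist v 0 = 1}"
  proof (intro equalityI subsetI)
    fix v assume "v \<in> weight1_vector ` {1..33}"
    then obtain k where "v = weight1_vector k" by blast
    moreover have "{i. weight1_vector k $ i \<noteq> 0 $ i} = {?i k}"
      using lists[of "(k - 1) mod 3"] unfolding weight1_vector_def by (auto simp: axis_def)
    ultimately show "v \<in> {v. hamming_dist v 0 = 1}"
      by (simp add: hamming_dist_def)
  next
    fix v :: "gf4 ^ 11" assume "v \<in> {v. hamming_dist v 0 = 1}"
    then obtain i where "{j. v $ j \<noteq> 0 $ j} = {i}"
      by (auto simp: hamming_dist_def card_1_singleton_iff)
    then have nz: "v $ i \<noteq> 0" and z: "\<And>j. j \<noteq> i \<Longrightarrow> v $ j = 0"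
      by auto
    have v: "v = axis i (v $ i)"
      using z by (auto simp: vec_eq_iff axis_def)
    obtain r where r: "r < 3" "v $ i = [1, \<omega>, \<omega>\<^sup>2] ! r"
    proof -
      have "v $ i \<in> set [1, \<omega>, \<omega>\<^sup>2]"
        using nz UNIV_gf4_\<omega> by auto
      then show thesis
        using that[of 0] that[of 1] that[of 2] by auto
    qed
    obtain m where m: "m < 11" "i = of_nat (m + 1)"
    proof -
      have "card ((\<lambda>m. of_nat (m + 1) :: 11) ` {..<11}) = CARD(11)"
        using idx_inj by (subst card_image) (auto intro!: inj_onI)
      then have "(\<lambda>m. of_nat (m + 1) :: 11) ` {..<11} = UNIV"
        by (intro card_subset_eq) auto
      then show thesis
        using that by blast
    qed
    have "v = weight1_vector (3 * m + r + 1)"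
      using v r m by (simp add: weight1_vector_def)
    moreover have "3 * m + r + 1 \<in> {1..33}"
      using r(1) m(1) by auto
    ultimately show "v \<in> weight1_vector ` {1..33}"
      by blast
  qed
qed

text \<open>
  Meaningful when \<open>f\<close> permutes the vectors of weight 1, as every monomial transformation does.
\<close>

definition weight1_action :: "(gf4 ^ 11 \<Rightarrow> gf4 ^ 11) \<Rightarrow> nat \<Rightarrow> nat" where
  "weight1_action f k =
     (if k \<in> {1..33} then inv_into {1..33} weight1_vector (f (weight1_vector k)) else k)"

definition gen1 :: "nat \<Rightarrow> nat" where
  "gen1 = cycle_of_list [1,4,27,29,14,18] \<circ> cycle_of_list [2,5,25,30,15,16] \<circ>
          cycle_of_list [3,6,26,28,13,17] \<circ> cycle_of_list [7,9,8] \<circ>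
          cycle_of_list [10,22,12,24,11,23] \<circ> cycle_of_list [19,31,20,32,21,33]"

definition gen2 :: "nat \<Rightarrow> nat" where
  "gen2 = cycle_of_list [4,32] \<circ> cycle_of_list [5,33] \<circ> cycle_of_list [6,31] \<circ>
          cycle_of_list [7,17] \<circ> cycle_of_list [8,18] \<circ> cycle_of_list [9,16] \<circ>
          cycle_of_list [10,23] \<circ> cycle_of_list [11,24] \<circ> cycle_of_list [12,22] \<circ>
          cycle_of_list [13,27] \<circ> cycle_of_list [14,25] \<circ> cycle_of_list [15,26] \<circ>
          cycle_of_list [19,28] \<circ> cycle_of_list [20,29] \<circ> cycle_of_list [21,30]"

end

theory Submission
  imports Defs
begin

text \<open>
  An isometry fixing the origin permutes the coordinates and acts on each of them by a permutation
  of the nonzero symbols; such a permutation is automatically additive. After a translation by a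
  codeword it therefore suffices to find the isometries that fix the origin and preserve the code.

  The code has minimum distance 5 and exactly 9 words of weight 5 whose support is also the support
  of another word of weight 5. All of them are nonzero in the coordinates 4 and 8, and in no other
  common coordinate, so every automorphism preserves the pair of coordinates 4, 8 and hence maps the
  first unit vector to one of the 27 weight-one vectors supported on the remaining coordinates. The
  two generators realise all \<open>27 \<cdot> 2\<close> possible images of the first unit vector and of coordinate 4,
  and a backtracking search, pruned by the words of weight 5, shows that an automorphism fixing both
  is the identity. So the group has order 54 and is generated by the two generators.
\<close>

section \<open>Hamming isometries fixing the origin\<close>

lemma hamming_dist_0_iff: "hamming_dist x y = 0 \<longleftrightarrow> x = (y :: 'a ^ 'n::finite)"
  by (auto simp: hamming_dist_def vec_eq_iff)

lemma hamming_dist_split: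
  fixes x y :: "'a ^ 'n::finite"
  shows "hamming_dist x y = card {i. i \<noteq> j \<and> x $ i \<noteq> y $ i} + of_bool (x $ j \<noteq> y $ j)"
proof (cases "x $ j = y $ j")
  case True
  then have "{i. x $ i \<noteq> y $ i} = {i. i \<noteq> j \<and> x $ i \<noteq> y $ i}" by auto
  then show ?thesis using True by (simp add: hamming_dist_def)
next
  case False
  then have "{i. x $ i \<noteq> y $ i} = insert j {i. i \<noteq> j \<and> x $ i \<noteq> y $ i}" by auto
  then show ?thesis using False by (simp add: hamming_dist_def)
qed

text \<open>The two distances differ only through coordinate \<open>j\<close>. So the distances from
  \<open>y\<close> to 0 and to the words of weight one reveal every entry of
  \<open>y\<close>.\<close>

lemma hamming_dist_axis:
  fixes y :: "'a::zero ^ 'n::finite"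
  assumes "b \<noteq> 0"
  shows "hamming_dist y (axis j b) + 1 = hamming_dist y 0 \<longleftrightarrow> y $ j = b"
    and "hamming_dist y (axis j b) = hamming_dist y 0 + 1 \<longleftrightarrow> y $ j = 0"
proof -
  have "{i. i \<noteq> j \<and> y $ i \<noteq> axis j b $ i} = {i. i \<noteq> j \<and> y $ i \<noteq> 0 $ i}"
    by (auto simp: axis_def)
  then show "hamming_dist y (axis j b) + 1 = hamming_dist y 0 \<longleftrightarrow> y $ j = b"
    and "hamming_dist y (axis j b) = hamming_dist y 0 + 1 \<longleftrightarrow> y $ j = 0"
    using assms by (auto simp: hamming_dist_split[where j = j])
qed

lemma hamming_dist_axis_axis:
  fixes a b :: "'a::zero"
  shows "hamming_dist (axis i a :: 'a ^ 'n::finite) (axis i b) = of_bool (a \<noteq> b)"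
    and "i \<noteq> j \<Longrightarrow> a \<noteq> 0 \<Longrightarrow> b \<noteq> 0 \<Longrightarrow> hamming_dist (axis i a :: 'a ^ 'n) (axis j b) = 2"
proof -
  have "{k. k \<noteq> i \<and> axis i a $ k \<noteq> axis i b $ k} = {}" by (auto simp: axis_def)
  then show "hamming_dist (axis i a :: 'a ^ 'n) (axis i b) = of_bool (a \<noteq> b)"
    by (subst hamming_dist_split[where j = i]) simp
  assume *: "i \<noteq> j" "a \<noteq> 0" "b \<noteq> 0"
  then have "{k. axis i a $ k \<noteq> axis j b $ k} = {i, j}" by (auto simp: axis_def)
  then show "hamming_dist (axis i a :: 'a ^ 'n) (axis j b) = 2"
    using * by (simp add: hamming_dist_def)
qed

lemma weight_1_axis:
  fixes v :: "'a::zero ^ 'n::finite"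
  assumes "hamming_dist v 0 = 1"
  obtains i a where "a \<noteq> 0" "v = axis i a"
proof -
  obtain i where "{j. v $ j \<noteq> 0 $ j} = {i}"
    using assms by (auto simp: hamming_dist_def card_1_singleton_iff)
  then have "v $ i \<noteq> 0" "v = axis i (v $ i)"
    by (auto simp: vec_eq_iff axis_def)
  then show thesis using that by blast
qed

text \<open>Words of weight one go to words of weight one, which defines the coordinate permutation
  and the symbol maps. The entries of every other image are then forced by its distances to 0 and to
  such words.\<close>

lemma isometry_fixing_zero_coordinatewise:
  fixes f :: "'a::zero_neq_one ^ 'n::finite \<Rightarrow> 'a ^ 'n"
  assumes iso: "\<And>x y. hamming_dist (f x) (f y) = hamming_dist x y" and f0: "f 0 = 0"
  obtains \<pi> s where "bij \<pi>" "\<And>i. s i 0 = 0" "\<And>i. inj (s i)"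
    "\<And>x i. f x $ \<pi> i = s i (x $ i)"
proof -
  have "\<exists>j b. b \<noteq> 0 \<and> f (axis i a) = axis j b" if "a \<noteq> 0" for i a
  proof -
    have "hamming_dist (axis i a) (axis i 0) = 1"
      using that by (simp add: hamming_dist_axis_axis)
    then have "hamming_dist (f (axis i a)) 0 = 1"
      using iso[of "axis i a" 0] f0 by (simp add: axis_eq_0_iff[THEN iffD2])
    then obtain j b where "b \<noteq> 0" "f (axis i a) = axis j b"
      by (rule weight_1_axis)
    then show ?thesis by blast
  qed
  then have "\<forall>i a. \<exists>j b. a \<noteq> 0 \<longrightarrow> b \<noteq> 0 \<and> f (axis i a) = axis j b"
    by blast
  then obtain P S where PS: "\<And>i a. a \<noteq> 0 \<Longrightarrow> S i a \<noteq> 0 \<and> f (axis i a) = axis (P i a) (S i a)"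
    unfolding choice_iff by blast
  define \<pi> where "\<pi> i = P i 1" for i
  define s where "s i a = (if a = 0 then 0 else S i a)" for i a
  \<comment> \<open>Words of weight one on the same coordinate are at distance at most 1, whereas
    images on different coordinates would be at distance 2. So the target coordinate does not depend
    on the symbol.\<close>
  have P: "P i a = \<pi> i" if "a \<noteq> 0" for i a
  proof (rule ccontr)
    assume "P i a \<noteq> \<pi> i"
    then have "hamming_dist (f (axis i a)) (f (axis i 1)) = 2"
      using PS[of a i] PS[of 1 i] that by (simp add: \<pi>_def hamming_dist_axis_axis)
    then show False by (cases "a = 1") (simp_all add: iso hamming_dist_axis_axis)
  qed
  have fa: "f (axis i a) = axis (\<pi> i) (s i a)" for i a
    using PS[of a i] P[of a i] f0 by (cases "a = 0") (auto simp: s_def axis_eq_0_iff[THEN iffD2])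
  have s0: "s i a = 0 \<longleftrightarrow> a = 0" for i a using PS by (simp add: s_def)
  have "f x $ \<pi> i = s i (x $ i)" for x i
  proof (cases "x $ i = 0")
    case True
    \<comment> \<open>A zero entry is detected by any nonzero symbol at its coordinate; 1 serves
      here.\<close>
    then have "hamming_dist x (axis i 1) = hamming_dist x 0 + 1"
      using hamming_dist_axis(2)[of 1 x i] by simp
    then have "hamming_dist (f x) (axis (\<pi> i) (s i 1)) = hamming_dist (f x) 0 + 1"
      using iso[of x "axis i 1"] iso[of x 0] by (simp add: fa f0)
    then show ?thesis
      using True s0[of i 1] s0[of i 0] hamming_dist_axis(2)[of "s i 1" "f x" "\<pi> i"] by simp
  next
    case False
    then have "hamming_dist x (axis i (x $ i)) + 1 = hamming_dist x 0"
      using hamming_dist_axis(1)[of "x $ i" x i] by simp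
    then have "hamming_dist (f x) (axis (\<pi> i) (s i (x $ i))) + 1 = hamming_dist (f x) 0"
      using iso[of x "axis i (x $ i)"] iso[of x 0] by (simp add: fa f0)
    then show ?thesis
      using False s0[of i "x $ i"] hamming_dist_axis(1)[of "s i (x $ i)" "f x" "\<pi> i"] by simp
  qed
  moreover have "inj (s i)" for i
  proof (rule injI)
    fix a b assume "s i a = s i b"
    then have "hamming_dist (f (axis i a)) (f (axis i b)) = 0"
      by (simp add: fa hamming_dist_0_iff)
    then show "a = b" by (simp add: iso hamming_dist_axis_axis split: if_splits)
  qed
  moreover have "bij \<pi>"
  proof -
    have "inj \<pi>"
    proof (rule injI, rule ccontr)
      fix i j assume "\<pi> i = \<pi> j" "i \<noteq> j"
      then have "hamming_dist (f (axis i 1)) (f (axis j 1)) \<noteq> 2"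
        by (simp add: fa hamming_dist_axis_axis)
      then show False using \<open>i \<noteq> j\<close> by (simp add: iso hamming_dist_axis_axis)
    qed
    then show ?thesis by (simp add: bij_def finite_UNIV_inj_surj)
  qed
  ultimately show thesis using s0 by (intro that[of \<pi> s]) auto
qed

section \<open>Coordinates as lists\<close>

text \<open>List positions count from 0, so position \<open>k\<close> holds coordinate \<open>k + 1\<close> of the paper.\<close>

definition coord :: "nat \<Rightarrow> 11" where
  "coord k = of_nat (Suc k)"

lemma inj_on_coord: "inj_on coord {..<11}"
proof (rule inj_onI)
  fix k l :: nat
  assume *: "k \<in> {..<11}" "l \<in> {..<11}" "coord k = coord l"
  then have "[Suc k = Suc l] (mod 11)"
    using of_nat_eq_iff_cong_CHAR[of "Suc k" "Suc l", where 'a = 11]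
    by (simp add: coord_def del: of_nat_Suc)
  then have "[k + 1 = l + 1] (mod 11)" by simp
  then have "[k = l] (mod 11)" by (simp only: cong_add_rcancel_nat)
  then show "k = l" using * by (simp add: cong_def)
qed

lemma bij_betw_coord: "bij_betw coord {..<11} UNIV"
proof -
  have "card (coord ` {..<11}) = CARD(11)"
    by (simp add: card_image inj_on_coord)
  then have "coord ` {..<11} = UNIV" by (intro card_subset_eq) auto
  then show ?thesis by (simp add: bij_betw_def inj_on_coord)
qed

lemma coord_eq_iff [simp]: "k < 11 \<Longrightarrow> l < 11 \<Longrightarrow> coord k = coord l \<longleftrightarrow> k = l"
  using inj_on_coord by (auto simp: inj_on_def)

lemma coord_cases: obtains k where "k < 11" "i = coord k"
  using bij_betw_coord by (auto simp: bij_betw_def)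

lemma all_coord: "(\<forall>i. P i) \<longleftrightarrow> (\<forall>k<11. P (coord k))"
  by (metis coord_cases)

definition entries :: "'a ^ 11 \<Rightarrow> 'a list" where
  "entries x = map (\<lambda>k. x $ coord k) [0..<11]"

lemma length_entries [simp]: "length (entries x) = 11"
  by (simp add: entries_def)

lemma nth_entries [simp]: "k < 11 \<Longrightarrow> entries x ! k = x $ coord k"
  by (simp add: entries_def)

lemma entries_eq_iff [simp]: "entries x = entries y \<longleftrightarrow> x = y"
  by (simp add: list_eq_iff_nth_eq vec_eq_iff all_coord[of "\<lambda>i. x $ i = y $ i"])

text \<open>\<open>vector\<close> writes its entries by nested updates at the indices 1, 2, ..., the
  first entry outermost. The induction needs an arbitrary starting index \<open>n\<close>.\<close>

lemma vector_nth:
  fixes xs :: "'a::zero list"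
  assumes "length xs \<le> 11" "k < length xs"
  shows "(vector xs :: 'a ^ 11) $ coord k = xs ! k"
proof -
  have "foldr (\<lambda>x f n. fun_upd (f (n + 1)) n x) xs (\<lambda>n x. 0) n (n + of_nat k) = xs ! k"
    if "length xs \<le> 11" "k < length xs" for n :: 11 and k and xs :: "'a list"
    using that
  proof (induction xs arbitrary: n k)
    case (Cons x xs)
    show ?case
    proof (cases k)
      case (Suc m)
      \<comment> \<open>Indices wrap around modulo 11; the length bound keeps later positions from
        meeting the index of the head.\<close>
      have "(of_nat k :: 11) \<noteq> 0"
      proof
        assume "(of_nat k :: 11) = 0"
        then have "11 dvd k" using of_nat_eq_0_iff_char_dvd[of k, where 'a = 11] by simp
        then show False using Cons.prems Suc by (auto dest: dvd_imp_le)
      qed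
      moreover have "n + of_nat k = (n + 1) + (of_nat m :: 11)" using Suc by simp
      ultimately show ?thesis using Cons.IH[of m "n + 1"] Cons.prems Suc by (simp add: add.assoc)
    qed simp
  qed simp
  from this[OF assms, of 1] show ?thesis
    by (simp add: vector_def coord_def)
qed

lemma entries_vector [simp]: "length xs = 11 \<Longrightarrow> entries (vector xs) = xs"
  by (auto simp: list_eq_iff_nth_eq vector_nth)

section \<open>Enumeration of the code\<close>

type_synonym word = "gf4 list"

definition gens :: "word list" where
  "gens =
    [[0,0,0,0,0,\<omega>\<^sup>2,\<omega>\<^sup>2,0,\<omega>,1,\<omega>],
     [0,0,0,0,0,\<omega>,0,\<omega>,\<omega>,\<omega>,1],
     [1,0,0,0,0,1,0,1,\<omega>\<^sup>2,\<omega>\<^sup>2,1],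
     [\<omega>,0,0,0,0,0,\<omega>,1,\<omega>,\<omega>,\<omega>],
     [0,1,0,0,0,0,1,1,1,\<omega>\<^sup>2,\<omega>\<^sup>2],
     [0,\<omega>,0,0,0,\<omega>\<^sup>2,1,\<omega>\<^sup>2,\<omega>,\<omega>,0],
     [0,0,1,0,0,\<omega>,\<omega>,1,1,0,1],
     [0,0,\<omega>,0,0,\<omega>,1,\<omega>,\<omega>\<^sup>2,\<omega>\<^sup>2,0],
     [0,0,0,1,0,\<omega>,\<omega>,\<omega>,0,1,\<omega>],
     [0,0,0,\<omega>,0,\<omega>\<^sup>2,1,1,\<omega>\<^sup>2,0,\<omega>],
     [0,0,0,0,1,\<omega>\<^sup>2,\<omega>\<^sup>2,\<omega>\<^sup>2,1,0,\<omega>\<^sup>2],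
     [0,0,0,0,\<omega>,\<omega>,1,0,1,\<omega>,\<omega>]]"

fun add_word :: "word \<Rightarrow> word \<Rightarrow> word" where
  "add_word (x # xs) (y # ys) = (x + y) # add_word xs ys"
| "add_word _ _ = []"

abbreviation zero_word :: word where
  "zero_word \<equiv> replicate 11 0"

text \<open>Runs through the coset of \<open>w\<close>, each generator being either left out or
  added, and keeps only the hits. With different predicates it decides membership and independence
  and finds the words of weight 5.\<close>

fun coset_filter :: "(word \<Rightarrow> bool) \<Rightarrow> word \<Rightarrow> word list \<Rightarrow> word list" where
  "coset_filter P w [] = (if P w then [w] else [])"
| "coset_filter P w (b # bs) = coset_filter P w bs @ coset_filter P (add_word w b) bs"

fun independent_words :: "word list \<Rightarrow> bool" where
  "independent_words [] \<longleftrightarrow> True"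
| "independent_words (b # bs) \<longleftrightarrow> coset_filter ((=) b) zero_word bs = [] \<and> independent_words bs"

fun has_weight :: "nat \<Rightarrow> word \<Rightarrow> bool" where
  "has_weight n [] \<longleftrightarrow> n = 0"
| "has_weight n (x # xs) \<longleftrightarrow>
     (x = 0 \<and> has_weight n xs) \<or> (x \<noteq> 0 \<and> n \<noteq> 0 \<and> has_weight (n - 1) xs)"

definition min_words :: "word list" where
  "min_words = coset_filter (has_weight 5) zero_word gens"

text \<open>Splits the list by zero or nonzero entry at positions \<open>n - 1\<close> down to 0, so
  that only words with equal zero pattern end up together. Comparing all pairs of words is
  avoided.\<close>

fun sharing_support :: "nat \<Rightarrow> word list \<Rightarrow> word list" where
  "sharing_support n [] = []"
| "sharing_support 0 W = filter (\<lambda>u. list_ex (\<lambda>v. v \<noteq> u) W) W"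
| "sharing_support (Suc n) W =
     sharing_support n (filter (\<lambda>w. w ! n = 0) W) @ sharing_support n (filter (\<lambda>w. w ! n \<noteq> 0) W)"

definition special_words :: "word list" where
  "special_words = sharing_support 11 min_words"

section \<open>Correctness of the enumeration by cosets\<close>

lemma add_word_conv_map2: "add_word u v = map2 (+) u v"
  by (induction u v rule: add_word.induct) auto

lemma entries_add: "entries (x + y) = add_word (entries x) (entries y)"
  by (simp add: add_word_conv_map2 list_eq_iff_nth_eq)

lemma entries_zero: "entries 0 = zero_word"
  by (simp add: list_eq_iff_nth_eq)

lemma length_gens: "b \<in> set gens \<Longrightarrow> length b = 11"
  by (auto simp: gens_def)

lemma D_minus_gens: "D_minus = f2_span (vector ` set gens)"
  by (simp add: D_minus_def gens_def)

interpretation f2: vector_space f2_scale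
  by (rule vector_space_f2_scale)

lemma gf4_add_self [simp]: "a + a = (0 :: gf4)"
  by (cases a) (simp_all add: zero_gf4_def)

lemma gf4_vec_add_self [simp]: "x + x = (0 :: gf4 ^ 'n)"
  by (simp only: vec_eq_iff vector_add_component gf4_add_self zero_index simp_thms)

lemma gf4_vec_add_self_left [simp]: "x + (x + y) = (y :: gf4 ^ 'n)"
  by (simp flip: add.assoc)

lemma gf4_vec_diff_eq_add: "x - y = x + (y :: gf4 ^ 'n)"
  by (simp add: vec_eq_iff minus_gf4_def)

lemma f2_span_add: "x \<in> f2_span S \<Longrightarrow> y \<in> f2_span S \<Longrightarrow> x + y \<in> f2_span S"
  by (simp add: f2_span_def f2.span_add)

text \<open>The only scalars are 0 and 1, and subtraction is addition. The two alternatives match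
  the two branches of \<open>coset_filter\<close>.\<close>

lemma f2_span_insert: "y \<in> f2_span (insert b S) \<longleftrightarrow> y \<in> f2_span S \<or> y + b \<in> f2_span S"
proof -
  have "(\<exists>k. y - f2_scale k b \<in> f2_span S) \<longleftrightarrow>
      y - f2_scale 0 b \<in> f2_span S \<or> y - f2_scale 1 b \<in> f2_span S"
    by (metis (full_types) bit.exhaust)
  then show ?thesis
    by (simp add: f2_span_def f2.span_insert gf4_vec_diff_eq_add)
qed

text \<open>In characteristic 2, lying in the coset of \<open>x\<close> means that
  \<open>y + x\<close> is in the span. The induction keeps \<open>x\<close> arbitrary because the
  second branch shifts the coset.\<close>

lemma entries_mem_coset_filter:
  assumes "\<forall>b\<in>set bs. length b = 11"
  shows "entries y \<in> set (coset_filter P (entries x) bs) \<longleftrightarrow>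
    P (entries y) \<and> y + x \<in> f2_span (vector ` set bs)"
  using assms
proof (induction bs arbitrary: x)
  case Nil
  have "y + x = 0 \<longleftrightarrow> y = x"
    by (metis add.right_neutral gf4_vec_add_self gf4_vec_add_self_left)
  then show ?case by (auto simp: f2_span_def)
next
  case (Cons b bs)
  then have "add_word (entries x) b = entries (x + vector b)"
    by (simp add: entries_add)
  then show ?case
    using Cons by (auto simp: f2_span_insert add.assoc)
qed

section \<open>Number of codewords\<close>

lemma length_coset_filter:
  assumes "\<forall>b\<in>set bs. length b = n" "length w = n" "v \<in> set (coset_filter P w bs)"
  shows "length v = n"
  using assms
proof (induction bs arbitrary: w)
  case (Cons b bs)
  then have "length (add_word w b) = n" by (simp add: add_word_conv_map2)
  with Cons show ?case by auto
qed (simp split: if_splits)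

text \<open>The larger span is the disjoint union of the smaller one and its translate by
  \<open>b\<close>: a common element would put \<open>b\<close> into the smaller span.\<close>

lemma card_f2_span_insert:
  assumes "b \<notin> f2_span S"
  shows "card (f2_span (insert b S)) = 2 * card (f2_span S)"
proof -
  have 1: "f2_span (insert b S) = f2_span S \<union> (+) b ` f2_span S"
  proof (rule Set.set_eqI)
    fix y
    have "y + b \<in> f2_span S \<longleftrightarrow> y \<in> (+) b ` f2_span S"
      by (metis (no_types, lifting) add.commute gf4_vec_add_self_left image_iff)
    then show "y \<in> f2_span (insert b S) \<longleftrightarrow> y \<in> f2_span S \<union> (+) b ` f2_span S"
      by (simp add: f2_span_insert)
  qed
  have 2: "f2_span S \<inter> (+) b ` f2_span S = {}"
  proof (rule ccontr)
    assume "f2_span S \<inter> (+) b ` f2_span S \<noteq> {}"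
    then obtain x where "x \<in> f2_span S" "b + x \<in> f2_span S" by auto
    from f2_span_add[OF this(2) this(1)] have "b \<in> f2_span S" by (simp add: add.assoc)
    with assms show False by simp
  qed
  have "card ((+) b ` f2_span S) = card (f2_span S)" by (simp add: card_image)
  with 2 show ?thesis by (simp add: 1 card_Un_disjoint)
qed

lemma card_f2_span_independent_words:
  assumes "independent_words bs" "\<forall>b\<in>set bs. length b = 11"
  shows "card (f2_span (vector ` set bs) :: (gf4 ^ 11) set) = 2 ^ length bs"
  using assms
proof (induction bs)
  case Nil
  then show ?case by (simp add: f2_span_def)
next
  case (Cons b bs)
  have "(vector b :: gf4 ^ 11) \<notin> f2_span (vector ` set bs)"
    using Cons.prems entries_mem_coset_filter[of bs "vector b" "(=) b" 0]
    by (simp add: entries_zero)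
  then show ?case using Cons by (simp add: card_f2_span_insert)
qed

lemma card_D_minus: "card D_minus = 2 ^ 12"
proof -
  have "independent_words gens" by code_simp
  moreover have "length gens = 12" by (simp add: gens_def)
  ultimately show ?thesis
    by (simp add: D_minus_gens card_f2_span_independent_words length_gens)
qed

lemma D_minus_add: "x \<in> D_minus \<Longrightarrow> y \<in> D_minus \<Longrightarrow> x + y \<in> D_minus"
  by (simp add: D_minus_gens f2_span_add)

lemma zero_mem_D_minus: "0 \<in> D_minus"
  by (simp add: D_minus_gens f2_span_def f2.span_zero)

section \<open>Words of weight 5 and shared supports\<close>

lemma has_weight_conv_filter: "has_weight n xs \<longleftrightarrow> length (filter (\<lambda>x. x \<noteq> 0) xs) = n"
proof (induction xs arbitrary: n)
  case (Cons x xs)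
  then show ?case by (cases n) auto
qed auto

lemma has_weight_entries: "has_weight n (entries x) \<longleftrightarrow> hamming_dist x 0 = n"
proof -
  have "bij_betw coord {k. k < 11 \<and> x $ coord k \<noteq> 0} {i. x $ i \<noteq> 0 $ i}"
    unfolding bij_betw_def
    by (auto intro!: inj_onI elim: coord_cases) (metis (mono_tags, lifting) coord_cases image_eqI mem_Collect_eq)
  then have "hamming_dist x 0 = card {k. k < 11 \<and> x $ coord k \<noteq> 0}"
    by (simp add: hamming_dist_def bij_betw_same_card)
  moreover have "{k. k < 11 \<and> entries x ! k \<noteq> 0} = {k. k < 11 \<and> x $ coord k \<noteq> 0}" by auto
  ultimately show ?thesis
    by (simp add: has_weight_conv_filter length_filter_conv_card)
qed

lemma entries_mem_min_words:
  "entries x \<in> set min_words \<longleftrightarrow> x \<in> D_minus \<and> hamming_dist x 0 = 5"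
  using entries_mem_coset_filter[of gens x "has_weight 5" 0] length_gens
  by (auto simp: min_words_def entries_zero has_weight_entries D_minus_gens)

lemma min_words_entries:
  assumes "w \<in> set min_words"
  shows "entries (vector w) = w"
  using assms length_gens length_coset_filter[of gens 11 zero_word w "has_weight 5"]
  by (simp add: min_words_def)

lemma mem_sharing_support:
  "u \<in> set (sharing_support n W) \<longleftrightarrow>
     u \<in> set W \<and> (\<exists>v\<in>set W. v \<noteq> u \<and> (\<forall>k<n. v ! k = 0 \<longleftrightarrow> u ! k = 0))"
proof (induction n W rule: sharing_support.induct)
  case (3 n w W)
  show ?case
    unfolding sharing_support.simps(3) set_append Un_iff 3 by (auto simp: less_Suc_eq)
qed (auto simp: list_ex_iff)

lemma entries_mem_special_words:
  "entries x \<in> set special_words \<longleftrightarrow>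
     x \<in> D_minus \<and> hamming_dist x 0 = 5 \<and>
     (\<exists>y. y \<in> D_minus \<and> hamming_dist y 0 = 5 \<and> y \<noteq> x \<and> (\<forall>i. y $ i = 0 \<longleftrightarrow> x $ i = 0))"
proof -
  have "(\<exists>v\<in>set min_words. P v) \<longleftrightarrow> (\<exists>y. entries y \<in> set min_words \<and> P (entries y))" for P
    using min_words_entries by metis
  then show ?thesis
    by (simp add: special_words_def mem_sharing_support entries_mem_min_words conj_assoc
        all_coord[of "\<lambda>i. _ $ i = 0 \<longleftrightarrow> _ $ i = 0"])
qed

lemma special_words_entries: "w \<in> set special_words \<Longrightarrow> entries (vector w) = w"
  by (simp add: special_words_def mem_sharing_support min_words_entries)

section \<open>Backtracking search\<close>

text \<open>
  A permutation of the nonzero symbols is the triple of its values at \<open>1\<close>, \<open>\<omega>\<close>, \<open>\<omega>\<^sup>2\<close>. An entry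
  \<open>(c, j, t)\<close> of an assignment says that the symbol at position \<open>c\<close> is moved to position \<open>j\<close> and
  changed by \<open>t\<close>.
\<close>

type_synonym sperm = "gf4 \<times> gf4 \<times> gf4"

fun apply_sperm :: "sperm \<Rightarrow> gf4 \<Rightarrow> gf4" where
  "apply_sperm (a, b, c) F4_0 = F4_0"
| "apply_sperm (a, b, c) F4_1 = a"
| "apply_sperm (a, b, c) F4_\<omega> = b"
| "apply_sperm (a, b, c) F4_\<omega>2 = c"

definition sperms :: "sperm list" where
  "sperms = [(F4_1, F4_\<omega>, F4_\<omega>2), (F4_1, F4_\<omega>2, F4_\<omega>), (F4_\<omega>, F4_1, F4_\<omega>2),
             (F4_\<omega>, F4_\<omega>2, F4_1), (F4_\<omega>2, F4_1, F4_\<omega>), (F4_\<omega>2, F4_\<omega>, F4_1)]"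

type_synonym assignment = "(nat \<times> nat \<times> sperm) list"

definition sends :: "assignment \<Rightarrow> word \<Rightarrow> word \<Rightarrow> bool" where
  "sends a u v \<longleftrightarrow> list_all (\<lambda>(c, j, t). v ! j = apply_sperm t (u ! c)) a"

text \<open>A necessary condition for \<open>a\<close> to extend to an automorphism: as far as the
  assigned positions can tell, every word of \<open>U\<close> has a possible image in
  \<open>W\<close>.\<close>

definition feasible :: "word list \<Rightarrow> word list \<Rightarrow> assignment \<Rightarrow> bool" where
  "feasible U W a \<longleftrightarrow> list_all (\<lambda>u. list_ex (sends a u) W) U"

text \<open>Found by experiment: these three words already cut the search down to a single branch.\<close>

definition test_words :: "word list" where
  "test_words =
    [[\<omega>\<^sup>2,\<omega>,0,0,0,\<omega>\<^sup>2,0,1,\<omega>\<^sup>2,0,0],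
     [1,0,\<omega>,1,0,0,0,\<omega>\<^sup>2,0,\<omega>,0],
     [\<omega>,0,0,0,0,\<omega>\<^sup>2,1,1,0,\<omega>\<^sup>2,0]]"

definition prune :: "word list \<Rightarrow> word list \<Rightarrow> assignment list \<Rightarrow> assignment list" where
  "prune S W as = filter (feasible test_words W) (filter (feasible S S) as)"

text \<open>All eleven targets are tried, also those taken already. Completeness of the search only
  asks that the true extension be among the candidates.\<close>

definition assign_coord :: "nat \<Rightarrow> assignment list \<Rightarrow> assignment list" where
  "assign_coord c as =
     concat (map (\<lambda>a. concat (map (\<lambda>j. map (\<lambda>t. (c, j, t) # a) sperms) [0..<11])) as)"

text \<open>Describes the stabiliser of coordinate 4 and of the first unit vector: position 3 stays
  in place with any change of symbols, position 0 with one that fixes the symbol 1.\<close>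

definition start_assignments :: "assignment list" where
  "start_assignments =
     concat (map (\<lambda>t. map (\<lambda>t'. [(3, 3, t), (0, 0, t')])
       (filter (\<lambda>t'. apply_sperm t' F4_1 = F4_1) sperms)) sperms)"

definition search :: "word list \<Rightarrow> word list \<Rightarrow> nat list \<Rightarrow> assignment list" where
  "search S W cs = fold (\<lambda>c as. prune S W (assign_coord c as)) cs (prune S W start_assignments)"

text \<open>The identity is the only survivor. New entries are put in front, so the positions appear
  in reverse order of their assignment.\<close>

lemma search_result:
  "search special_words min_words [7, 1, 2, 4, 5, 6, 8, 9, 10] =
     [map (\<lambda>c. (c, c, F4_1, F4_\<omega>, F4_\<omega>2)) [10, 9, 8, 6, 5, 4, 2, 1, 7, 3, 0]]"
  by code_simp

text \<open>Positions 3 and 7 are the coordinates 4 and 8, which the code thereby singles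
  out.\<close>

lemma common_support_special_words:
  "filter (\<lambda>j. list_all (\<lambda>w. w ! j \<noteq> 0) special_words) [0..<11] = [3, 7]"
  by code_simp

lemma test_words_min_words: "list_all (\<lambda>w. w \<in> set min_words) test_words"
  by code_simp

section \<open>Isometries fixing the origin in terms of list positions\<close>

definition acts_by :: "(nat \<Rightarrow> nat) \<Rightarrow> (nat \<Rightarrow> gf4 \<Rightarrow> gf4) \<Rightarrow> (gf4 ^ 11 \<Rightarrow> gf4 ^ 11) \<Rightarrow> bool" where
  "acts_by p s f \<longleftrightarrow>
     bij_betw p {..<11} {..<11} \<and> (\<forall>k<11. inj (s k) \<and> s k 0 = 0) \<and>
     (\<forall>x. \<forall>k<11. f x $ coord (p k) = s k (x $ coord k))"

lemma acts_by_less: "acts_by p s f \<Longrightarrow> k < 11 \<Longrightarrow> p k < 11"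
  by (auto simp: acts_by_def bij_betw_def)

lemma acts_by_nth: "acts_by p s f \<Longrightarrow> k < 11 \<Longrightarrow> f x $ coord (p k) = s k (x $ coord k)"
  by (simp add: acts_by_def)

lemma acts_by_surj:
  assumes "acts_by p s f" "j < 11"
  obtains k where "k < 11" "j = p k"
proof -
  have "j \<in> p ` {..<11}" using assms by (simp add: acts_by_def bij_betw_def)
  then show thesis using that by auto
qed

lemma isometry_acts_by:
  assumes "\<And>x y. hamming_dist (f x) (f y) = hamming_dist x y" "f 0 = 0"
  obtains p s where "acts_by p s f"
proof -
  obtain \<pi> s where \<pi>: "bij \<pi>" and s: "\<And>i. s i 0 = 0" "\<And>i. inj (s i)"
    and f: "\<And>x i. f x $ \<pi> i = s i (x $ i)"
    using isometry_fixing_zero_coordinatewise[of f] assms by blast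
  define p where "p = inv_into {..<11} coord \<circ> \<pi> \<circ> coord"
  have "bij_betw p {..<11} {..<11}"
    unfolding p_def using \<pi> bij_betw_coord
    by (intro bij_betw_trans[of _ _ UNIV] bij_betw_inv_into) auto
  moreover have "coord (p k) = \<pi> (coord k)" for k
    using bij_betw_inv_into_right[OF bij_betw_coord] by (simp add: p_def)
  ultimately have "acts_by p (\<lambda>k. s (coord k)) f"
    using s f by (simp add: acts_by_def)
  then show thesis by (rule that)
qed

lemma acts_by_axis:
  assumes "acts_by p s f" "k < 11"
  shows "f (axis (coord k) a) = axis (coord (p k)) (s k a)"
proof -
  have "f (axis (coord k) a) $ coord j = axis (coord (p k)) (s k a) $ coord j" if j: "j < 11" for j
  proof -
    obtain l where l: "l < 11" "j = p l" using acts_by_surj[OF assms(1) j] .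
    have "p l = p k \<longleftrightarrow> l = k"
      using assms l(1) by (auto simp: acts_by_def bij_betw_def inj_on_def)
    then show ?thesis
      using assms l acts_by_less[OF assms(1)] by (simp add: acts_by_nth axis_def) (simp add: acts_by_def)
  qed
  then show ?thesis by (simp add: vec_eq_iff all_coord)
qed

lemma gf4_perm_values:
  fixes s :: "gf4 \<Rightarrow> gf4"
  assumes "inj s" "s 0 = 0"
  shows "s F4_0 = F4_0" "s F4_1 \<noteq> F4_0" "s F4_\<omega> \<noteq> F4_0" "s F4_\<omega>2 \<noteq> F4_0"
    "s F4_1 \<noteq> s F4_\<omega>" "s F4_1 \<noteq> s F4_\<omega>2" "s F4_\<omega> \<noteq> s F4_\<omega>2"
proof -
  show s0: "s F4_0 = F4_0" using assms(2) by (simp add: zero_gf4_def)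
  show "s F4_1 \<noteq> F4_0" "s F4_\<omega> \<noteq> F4_0" "s F4_\<omega>2 \<noteq> F4_0"
    "s F4_1 \<noteq> s F4_\<omega>" "s F4_1 \<noteq> s F4_\<omega>2" "s F4_\<omega> \<noteq> s F4_\<omega>2"
    using injD[OF assms(1), of _ F4_0] by (auto simp: s0 inj_eq[OF assms(1)])
qed

text \<open>The sum of two distinct nonzero elements is the third one. So the six permutations of
  the nonzero elements are exactly the invertible F_2-linear maps of the field.\<close>

lemma gf4_perm_additive:
  fixes s :: "gf4 \<Rightarrow> gf4"
  assumes "inj s" "s 0 = 0"
  shows "s (a + b) = s a + s b"
proof -
  show ?thesis
    using gf4_perm_values[OF assms]
    by (cases "s F4_1"; cases "s F4_\<omega>"; cases "s F4_\<omega>2"; cases a; cases b)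
      (simp_all add: zero_gf4_def)
qed

lemma acts_by_add:
  assumes "acts_by p s f"
  shows "f (x + y) = f x + f y"
proof -
  have "f (x + y) $ coord j = (f x + f y) $ coord j" if "j < 11" for j
    using that by (rule acts_by_surj[OF assms])
      (use assms in \<open>simp add: acts_by_def gf4_perm_additive\<close>)
  then show ?thesis by (simp add: vec_eq_iff all_coord)
qed

definition agrees :: "(nat \<Rightarrow> nat) \<Rightarrow> (nat \<Rightarrow> gf4 \<Rightarrow> gf4) \<Rightarrow> assignment \<Rightarrow> bool" where
  "agrees p s a \<longleftrightarrow> (\<forall>(c, j, t)\<in>set a. c < 11 \<and> p c = j \<and> s c = apply_sperm t)"

lemma obtain_sperm:
  assumes "inj s" "s 0 = 0"
  obtains t where "t \<in> set sperms" "s = apply_sperm t"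
proof -
  note vals = gf4_perm_values[OF assms]
  then have "(s F4_1, s F4_\<omega>, s F4_\<omega>2) \<in> set sperms"
    by (cases "s F4_1"; cases "s F4_\<omega>"; cases "s F4_\<omega>2") (simp_all add: sperms_def)
  moreover have "s x = apply_sperm (s F4_1, s F4_\<omega>, s F4_\<omega>2) x" for x
    using vals by (cases x) simp_all
  ultimately show thesis using that by blast
qed

text \<open>The image under \<open>f\<close> itself witnesses feasibility of any assignment that is
  a part of \<open>f\<close>.\<close>

lemma feasible_if_agrees:
  assumes "acts_by p s f" "agrees p s a"
    and "\<And>u. u \<in> set U \<Longrightarrow> \<exists>x. u = entries x \<and> entries (f x) \<in> set W"
  shows "feasible U W a"
proof -
  have "sends a (entries x) (entries (f x))" for x
    using assms(2) acts_by_less[OF assms(1)] acts_by_nth[OF assms(1)]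
    by (auto simp: sends_def agrees_def list_all_iff)
  then show ?thesis
    using assms(3) by (fastforce simp: feasible_def list_all_iff list_ex_iff)
qed

lemma assign_coord_complete:
  assumes "acts_by p s f" "a \<in> set as" "agrees p s a" "c < 11"
  obtains b where "b \<in> set (assign_coord c as)" "agrees p s b"
proof -
  obtain t where "t \<in> set sperms" "s c = apply_sperm t"
    using assms by (auto simp: acts_by_def intro: obtain_sperm)
  then show thesis
    using assms acts_by_less[OF assms(1,4)]
    by (intro that[of "(c, p c, t) # a"])
      (auto simp: assign_coord_def agrees_def intro!: bexI[of _ a] bexI[of _ "p c"])
qed

section \<open>Automorphisms fixing the origin\<close>

definition origin_auts :: "(gf4 ^ 11 \<Rightarrow> gf4 ^ 11) set" where
  "origin_auts = {f \<in> carrier (complete_aut_group D_minus). f 0 = 0}"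

lemma mem_origin_auts:
  "f \<in> origin_auts \<longleftrightarrow>
     bij f \<and> (\<forall>x y. hamming_dist (f x) (f y) = hamming_dist x y) \<and> f ` D_minus = D_minus \<and> f 0 = 0"
  by (auto simp: origin_auts_def complete_aut_group_def carrier_hamming_isometry_group)

lemma origin_auts_acts_by:
  assumes "f \<in> origin_auts"
  obtains p s where "acts_by p s f"
  using assms isometry_acts_by[of f] by (auto simp: mem_origin_auts)

lemma origin_auts_min_words:
  assumes "f \<in> origin_auts" "entries x \<in> set min_words"
  shows "entries (f x) \<in> set min_words"
proof -
  have "f 0 = 0" "f ` D_minus = D_minus" "hamming_dist (f x) (f 0) = hamming_dist x 0"
    using assms(1) unfolding mem_origin_auts by blast+
  then show ?thesis using assms(2) by (auto simp: entries_mem_min_words)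
qed

text \<open>Membership in the code, weight, distinctness and equality of supports are all preserved,
  the last because symbols are changed by injections fixing 0.\<close>

lemma origin_auts_special_words:
  assumes f: "f \<in> origin_auts" and x: "entries x \<in> set special_words"
  shows "entries (f x) \<in> set special_words"
proof -
  obtain p s where ps: "acts_by p s f" using f by (rule origin_auts_acts_by)
  obtain y where y: "entries y \<in> set min_words" "y \<noteq> x" "\<And>i. y $ i = 0 \<longleftrightarrow> x $ i = 0"
    and x': "entries x \<in> set min_words"
    using x by (auto simp: entries_mem_special_words entries_mem_min_words)
  have "f y $ coord j = 0 \<longleftrightarrow> f x $ coord j = 0" if j: "j < 11" for j
  proof -
    obtain k where k: "k < 11" "j = p k" using acts_by_surj[OF ps j] .
    have "s k a = 0 \<longleftrightarrow> a = 0" for a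
      using ps k(1) by (metis acts_by_def injD)
    then show ?thesis using k ps y(3) by (simp add: acts_by_nth)
  qed
  then have "f y $ i = 0 \<longleftrightarrow> f x $ i = 0" for i by (metis coord_cases)
  moreover have "f y \<noteq> f x" using f y(2) by (auto simp: mem_origin_auts bij_def inj_eq)
  ultimately show ?thesis
    using origin_auts_min_words[OF f y(1)] origin_auts_min_words[OF f x']
    by (auto simp: entries_mem_special_words entries_mem_min_words)
qed

text \<open>Special words go to special words and words of weight 5 to words of weight 5, so neither
  filter loses a part of an automorphism.\<close>

lemma prune_complete:
  assumes "acts_by p s f" "f \<in> origin_auts" "a \<in> set as" "agrees p s a"
  shows "a \<in> set (prune special_words min_words as)"
proof -
  have "\<exists>x. u = entries x \<and> entries (f x) \<in> set special_words" if "u \<in> set special_words" for u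
    using that origin_auts_special_words[OF assms(2)] special_words_entries by metis
  moreover have "\<exists>x. u = entries x \<and> entries (f x) \<in> set min_words" if "u \<in> set test_words" for u
  proof -
    have "u \<in> set min_words" using that test_words_min_words by (simp add: list_all_iff)
    then show ?thesis using origin_auts_min_words[OF assms(2)] min_words_entries by metis
  qed
  ultimately show ?thesis
    using feasible_if_agrees[OF assms(1,4)] assms(3) by (simp add: prune_def)
qed

text \<open>Invariant of the fold: some assignment in the current list is a part of the given
  automorphism.\<close>

lemma search_complete:
  assumes "acts_by p s f" "f \<in> origin_auts" "p 0 = 0" "s 0 F4_1 = F4_1" "p 3 = 3"
    and "\<forall>c\<in>set cs. c < 11"
  shows "\<exists>a\<in>set (search special_words min_words cs). agrees p s a"
proof -
  have "\<exists>a\<in>set (fold (\<lambda>c as. prune special_words min_words (assign_coord c as)) cs as). agrees p s a"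
    if "\<exists>a\<in>set as. agrees p s a" "\<forall>c\<in>set cs. c < 11" for as cs
    using that
  proof (induction cs arbitrary: as)
    case (Cons c cs)
    then obtain a where "a \<in> set as" "agrees p s a" by blast
    then obtain b where "b \<in> set (assign_coord c as)" "agrees p s b"
      using assign_coord_complete[OF assms(1)] Cons.prems by (metis list.set_intros(1))
    then show ?case using Cons prune_complete[OF assms(1,2)] by simp blast
  qed simp
  moreover have "inj (s 3)" "s 3 0 = 0" "inj (s 0)" "s 0 0 = 0"
    using assms(1) by (simp_all add: acts_by_def)
  then obtain t t' where "t \<in> set sperms" "s 3 = apply_sperm t" "t' \<in> set sperms" "s 0 = apply_sperm t'"
    using obtain_sperm[of "s 3"] obtain_sperm[of "s 0"] by metis
  then have "[(3, 3, t), (0, 0, t')] \<in> set start_assignments" "agrees p s [(3, 3, t), (0, 0, t')]"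
    using assms by (auto simp: start_assignments_def agrees_def)
  then have "\<exists>a\<in>set (prune special_words min_words start_assignments). agrees p s a"
    using prune_complete[OF assms(1,2)] by blast
  ultimately show ?thesis using assms(6) by (simp add: search_def)
qed

text \<open>The search leaves a single assignment, which must therefore agree with \<open>f\<close>;
  it covers all eleven positions and is the identity on each.\<close>

lemma origin_auts_rigid:
  assumes ps: "acts_by p s f" and f: "f \<in> origin_auts"
    and fixed: "p 0 = 0" "s 0 F4_1 = F4_1" "p 3 = 3"
  shows "f = id"
proof -
  let ?t = "(F4_1, F4_\<omega>, F4_\<omega>2)"
  have "agrees p s (map (\<lambda>c. (c, c, ?t)) [10, 9, 8, 6, 5, 4, 2, 1, 7, 3, 0])"
    using search_complete[OF ps f fixed, of "[7, 1, 2, 4, 5, 6, 8, 9, 10]"]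
    by (simp only: search_result) simp
  moreover have "apply_sperm ?t = id"
  proof
    show "apply_sperm ?t x = id x" for x by (cases x) simp_all
  qed
  moreover have "k \<in> {10, 9, 8, 6, 5, 4, 2, 1, 7, 3, 0}" if "k < 11" for k :: nat
    using that by simp presburger
  ultimately have "p k = k \<and> s k = id" if "k < 11" for k
    using that unfolding agrees_def by fastforce
  then have "f x $ coord k = x $ coord k" if "k < 11" for x k
    using acts_by_nth[OF ps that, of x] that by simp
  then show ?thesis by (simp add: fun_eq_iff vec_eq_iff all_coord)
qed

text \<open>The special words are mapped onto themselves, so the positions where all of them are
  nonzero are permuted among themselves. Position 0 cannot be sent to 3 or 7, as both are taken by
  the images of 3 and 7.\<close>

lemma origin_auts_coords:
  assumes ps: "acts_by p s f" and f: "f \<in> origin_auts"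
  shows "p 3 \<in> {3, 7}" "p 0 \<notin> {3, 7}"
proof -
  define E where "E = {x. entries x \<in> set special_words}"
  have common: "(\<forall>x\<in>E. x $ coord j \<noteq> 0) \<longleftrightarrow> j \<in> {3, 7}" if "j < 11" for j
  proof -
    have "j \<in> set (filter (\<lambda>j. list_all (\<lambda>w. w ! j \<noteq> 0) special_words) [0..<11]) \<longleftrightarrow>
        (\<forall>w\<in>set special_words. w ! j \<noteq> 0)"
      using that by (simp add: list_all_iff)
    also have "\<dots> \<longleftrightarrow> (\<forall>x\<in>E. x $ coord j \<noteq> 0)"
      using that special_words_entries unfolding E_def by (metis mem_Collect_eq nth_entries)
    finally show ?thesis by (simp add: common_support_special_words)
  qed
  have "f ` E \<subseteq> E" using origin_auts_special_words[OF f] by (auto simp: E_def)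
  moreover have "inj_on f E" using f by (auto simp: mem_origin_auts bij_def intro: inj_on_subset)
  ultimately have E: "f ` E = E" by (intro endo_inj_surj) auto
  have p: "p k \<in> {3, 7}" if "k \<in> {3, 7}" for k
  proof -
    have k: "k < 11" using that by auto
    have "s k a = 0 \<Longrightarrow> a = 0" for a
      using ps k by (metis acts_by_def injD)
    then have "f x $ coord (p k) \<noteq> 0" if "x \<in> E" for x
      using common[OF k] that \<open>k \<in> {3, 7}\<close> acts_by_nth[OF ps k] by metis
    \<comment> \<open>Every special word is the image of one, so the claim about images covers all
      of \<open>E\<close>.\<close>
    then have "\<forall>x\<in>E. x $ coord (p k) \<noteq> 0" by (subst E[symmetric]) blast
    then show ?thesis using common acts_by_less[OF ps k] by blast
  qed
  then show "p 3 \<in> {3, 7}" by blast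
  have inj: "inj_on p {..<11}" using ps by (simp add: acts_by_def bij_betw_def)
  then have "p 0 \<noteq> p 3" "p 0 \<noteq> p 7" "p 3 \<noteq> p 7"
    by (simp_all add: inj_on_eq_iff)
  then show "p 0 \<notin> {3, 7}" using p[of 3] p[of 7] by auto
qed

section \<open>The generators\<close>

text \<open>Indexed by targets: position \<open>k\<close> receives its symbol from position
  \<open>P ! k\<close>. The permutation of positions in the sense of \<open>acts_by\<close> is thus
  the inverse of \<open>P\<close>.\<close>

definition monomial_map :: "nat list \<Rightarrow> gf4 list \<Rightarrow> gf4 ^ 11 \<Rightarrow> gf4 ^ 11" where
  "monomial_map P A x =
     (\<chi> i. A ! inv_into {..<11} coord i * x $ coord (P ! inv_into {..<11} coord i))"

definition monomial_word :: "nat list \<Rightarrow> gf4 list \<Rightarrow> word \<Rightarrow> word" where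
  "monomial_word P A w = map2 (\<lambda>j a. a * w ! j) P A"

lemma monomial_map_nth [simp]:
  "k < 11 \<Longrightarrow> monomial_map P A x $ coord k = A ! k * x $ coord (P ! k)"
  by (simp add: monomial_map_def inv_into_f_f inj_on_coord)

lemma entries_monomial_map:
  assumes "set P = {..<11}" "length P = 11" "length A = 11"
  shows "entries (monomial_map P A x) = monomial_word P A (entries x)"
proof (rule nth_equalityI)
  fix k assume "k < length (entries (monomial_map P A x))"
  then have "k < 11" by simp
  moreover have "P ! k < 11" using assms \<open>k < 11\<close> nth_mem[of k P] by auto
  ultimately show "entries (monomial_map P A x) ! k = monomial_word P A (entries x) ! k"
    using assms by (simp add: monomial_word_def)
qed (use assms in \<open>simp add: monomial_word_def\<close>)

lemma monomial_monomial_map: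
  assumes "distinct P" "set P = {..<11}" "length P = 11" "length A = 11" "0 \<notin> set A"
  shows "monomial (monomial_map P A)"
proof -
  let ?i = "inv_into {..<11} coord"
  have i: "bij_betw ?i UNIV {..<11}" using bij_betw_coord by (rule bij_betw_inv_into)
  have "bij_betw ((!) P) {..<11} {..<11}" using assms by (intro bij_betw_nth) simp_all
  then have "bij (coord \<circ> ((!) P \<circ> ?i))"
    using i bij_betw_coord by (blast intro: bij_betw_trans)
  moreover have "A ! ?i j \<noteq> 0" for j
  proof -
    have "?i j < 11" using i by (auto simp: bij_betw_def)
    then show ?thesis using assms nth_mem[of "?i j" A] by metis
  qed
  ultimately show ?thesis
    unfolding monomial_def
    by (intro exI[of _ "coord \<circ> ((!) P \<circ> ?i)"] exI[of _ "\<lambda>j. A ! ?i j"]) (auto simp: monomial_map_def)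
qed

lemma monomial_map_add: "monomial_map P A (x + y) = monomial_map P A x + monomial_map P A y"
  by (simp add: vec_eq_iff monomial_map_def distrib_left)

text \<open>An additive map is F_2-linear, so its values on the generators decide.\<close>

lemma additive_f2_span_subset:
  assumes add: "\<And>x y. f (x + y) = f x + f y" and f: "\<And>b. b \<in> set bs \<Longrightarrow> f (vector b) \<in> f2_span S"
    and y: "y \<in> f2_span (vector ` set bs)"
  shows "f y \<in> f2_span S"
  using f y
proof (induction bs arbitrary: y)
  case Nil
  then have "y = 0" by (simp add: f2_span_def)
  moreover have "f 0 = 0" using add[of 0 0] by simp
  ultimately show ?case by (simp add: f2_span_def f2.span_zero)
next
  case (Cons b bs)
  from Cons.prems(2) consider "y \<in> f2_span (vector ` set bs)" | "y + vector b \<in> f2_span (vector ` set bs)"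
    by (auto simp: f2_span_insert)
  then show ?case
  proof cases
    case 2
    then have "f (y + vector b) + f (vector b) \<in> f2_span S"
      using Cons by (intro f2_span_add) auto
    then show ?thesis by (simp add: add add.assoc)
  qed (use Cons in auto)
qed

text \<open>Together with \<open>scal1\<close> this encodes \<open>gen1\<close>: for instance 1 goes
  to 4, so position 1 takes its symbol from position 0 with scalar 1.\<close>

definition perm1 :: "nat list" where "perm1 = [5, 0, 2, 7, 9, 4, 10, 3, 1, 8, 6]"

definition scal1 :: "gf4 list" where
  "scal1 = [\<omega>, 1, \<omega>\<^sup>2, \<omega>\<^sup>2, 1, \<omega>, \<omega>, 1, \<omega>\<^sup>2, \<omega>\<^sup>2, 1]"

text \<open>Encodes \<open>gen2\<close> together with \<open>scal2\<close>; like \<open>gen2\<close>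
  it is an involution.\<close>

definition perm2 :: "nat list" where "perm2 = [0, 10, 5, 7, 8, 2, 9, 3, 4, 6, 1]"

definition scal2 :: "gf4 list" where
  "scal2 = [1, \<omega>\<^sup>2, \<omega>\<^sup>2, \<omega>\<^sup>2, \<omega>, \<omega>, 1, \<omega>, \<omega>\<^sup>2, 1, \<omega>]"

definition generator_data :: "(nat list \<times> gf4 list) list" where
  "generator_data = [(perm1, scal1), (perm2, scal2)]"

lemma generator_data_wf:
  assumes "(P, A) \<in> set generator_data"
  shows "distinct P" "set P = {..<11}" "length P = 11" "length A = 11" "0 \<notin> set A"
proof -
  have "list_all (\<lambda>(P, A). distinct P \<and> set P = set [0..<11] \<and> length P = 11 \<and> length A = 11 \<and>
      0 \<notin> set A) generator_data"
    by code_simp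
  with assms show "distinct P" "set P = {..<11}" "length P = 11" "length A = 11" "0 \<notin> set A"
    by (auto simp: list_all_iff)
qed

lemma generator_data_D_minus:
  "list_all (\<lambda>(P, A). list_all (\<lambda>b. coset_filter ((=) (monomial_word P A b)) zero_word gens \<noteq> []) gens)
    generator_data"
  by code_simp

text \<open>The images of the generators are found in the code by evaluation. Additivity gives
  inclusion for the whole code, and injectivity on a finite set gives equality.\<close>

lemma monomial_map_D_minus:
  assumes "(P, A) \<in> set generator_data"
  shows "monomial (monomial_map P A)" "monomial_map P A ` D_minus = D_minus"
proof -
  let ?f = "monomial_map P A"
  show mon: "monomial ?f" using generator_data_wf[OF assms] by (rule monomial_monomial_map)
  have "?f (vector b) \<in> D_minus" if "b \<in> set gens" for b
  proof -
    have "entries (?f (vector b)) = monomial_word P A b"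
      using generator_data_wf[OF assms] length_gens[OF that] by (simp add: entries_monomial_map)
    moreover have "coset_filter ((=) (monomial_word P A b)) zero_word gens \<noteq> []"
      using generator_data_D_minus assms that by (auto simp: list_all_iff)
    then obtain w where w: "w \<in> set (coset_filter ((=) (monomial_word P A b)) zero_word gens)"
      by (cases "coset_filter ((=) (monomial_word P A b)) zero_word gens") auto
    then have "entries (vector w) = w"
      using length_coset_filter[of gens 11 zero_word w] length_gens by simp
    with w have "vector w \<in> D_minus" "w = monomial_word P A b"
      using entries_mem_coset_filter[of gens "vector w" _ 0] length_gens
      by (auto simp: entries_zero D_minus_gens)
    ultimately show ?thesis using \<open>entries (vector w) = w\<close> by (metis entries_eq_iff)
  qed
  then have "?f ` D_minus \<subseteq> D_minus"
    using additive_f2_span_subset[of ?f gens "vector ` set gens"] monomial_map_add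
    by (auto simp: D_minus_gens)
  moreover have "inj_on ?f D_minus"
    using monomial_imp_isometry[OF mon]
    by (auto simp: carrier_hamming_isometry_group bij_def intro: inj_on_subset)
  ultimately show "?f ` D_minus = D_minus" by (intro endo_inj_surj) auto
qed

section \<open>The action on the vectors of weight one\<close>

lemma weight1_vector_eq_axis:
  "weight1_vector k = axis (coord ((k - 1) div 3)) ([1, \<omega>, \<omega>\<^sup>2] ! ((k - 1) mod 3))"
  by (simp add: weight1_vector_def coord_def)

lemma weight1_scalar_nonzero: "m < 3 \<Longrightarrow> [1, \<omega>, \<omega>\<^sup>2] ! m \<noteq> 0"
  unfolding \<omega>_squared_eq
  by (auto simp: less_Suc_eq numeral_3_eq_3 \<omega>_def zero_gf4_def one_gf4_def)

lemma axis_eq_axisD: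
  assumes "axis i a = axis j b" "a \<noteq> 0"
  shows "i = j" "a = b"
proof -
  have "axis i a $ i = axis j b $ i" using assms by simp
  then show "i = j" "a = b" using assms(2) by (auto simp: axis_def split: if_splits)
qed

text \<open>Each coordinate owns a block of three consecutive numbers, and
  \<open>(k - 1) div 3\<close> is its position. The last claim thus reads off the permutation of
  positions from the action on numbers.\<close>

lemma weight1_action:
  assumes ps: "acts_by p s f" and k: "k \<in> {1..33}"
  shows "weight1_action f k \<in> {1..33}"
    and "f (weight1_vector k) = weight1_vector (weight1_action f k)"
    and "(weight1_action f k - 1) div 3 = p ((k - 1) div 3)"
proof -
  define c where "c = (k - 1) div 3"
  define a where "a = [1, \<omega>, \<omega>\<^sup>2] ! ((k - 1) mod 3)"
  have c: "c < 11" using k by (auto simp: c_def)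
  have a: "a \<noteq> 0" using weight1_scalar_nonzero[of "(k - 1) mod 3"] by (simp add: a_def)
  have sa: "s c a \<noteq> 0" using ps c a by (metis acts_by_def injD)
  have f: "f (weight1_vector k) = axis (coord (p c)) (s c a)"
    using acts_by_axis[OF ps c] by (simp add: weight1_vector_eq_axis c_def a_def)
  have "hamming_dist (axis (coord (p c)) (s c a)) (axis (coord (p c)) 0) = 1"
    using sa by (simp add: hamming_dist_axis_axis)
  then have "f (weight1_vector k) \<in> {v. hamming_dist v 0 = 1}"
    by (simp add: f axis_eq_0_iff[THEN iffD2])
  then have im: "f (weight1_vector k) \<in> weight1_vector ` {1..33}"
    using bij_betw_weight1_vector by (simp add: bij_betw_def)
  then show mem: "weight1_action f k \<in> {1..33}"
    using k inv_into_into[OF im] by (simp add: weight1_action_def)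
  show eq: "f (weight1_vector k) = weight1_vector (weight1_action f k)"
    using k f_inv_into_f[OF im] by (simp add: weight1_action_def)
  have "coord (p c) = coord ((weight1_action f k - 1) div 3)"
    using axis_eq_axisD(1)[OF _ sa] eq f by (metis weight1_vector_eq_axis)
  moreover have "(weight1_action f k - 1) div 3 < 11" using mem by auto
  ultimately show "(weight1_action f k - 1) div 3 = p ((k - 1) div 3)"
    using acts_by_less[OF ps c] by (simp add: c_def)
qed

lemma weight1_action_eqI:
  assumes "\<And>k. k \<in> {1..33} \<Longrightarrow> g k \<in> {1..33} \<and> f (weight1_vector k) = weight1_vector (g k)"
    and "\<And>k. k \<notin> {1..33} \<Longrightarrow> g k = k"
  shows "weight1_action f = g"
proof
  fix k
  show "weight1_action f k = g k"
  proof (cases "k \<in> {1..33}")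
    case True
    then have "inv_into {1..33} weight1_vector (weight1_vector (g k)) = g k"
      using assms(1) bij_betw_weight1_vector by (intro inv_into_f_f) (auto simp: bij_betw_def)
    then show ?thesis using True assms(1)[OF True] by (simp only: weight1_action_def if_True)
  next
    case False
    then show ?thesis using assms(2)[OF False] by (simp only: weight1_action_def if_False)
  qed
qed

section \<open>Compatibility of the action with products and inverses\<close>

lemma origin_auts_comp: "f \<in> origin_auts \<Longrightarrow> g \<in> origin_auts \<Longrightarrow> f \<circ> g \<in> origin_auts"
  unfolding mem_origin_auts by (metis bij_comp comp_apply image_comp)

lemma id_mem_origin_auts: "id \<in> origin_auts"
  by (simp add: mem_origin_auts)

lemma origin_auts_inv:
  assumes "f \<in> origin_auts"
  shows "inv' f \<in> origin_auts"
proof -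
  have f: "bij f" "f ` D_minus = D_minus" "f 0 = 0"
    and iso: "\<And>x y. hamming_dist (f x) (f y) = hamming_dist x y"
    using assms by (auto simp only: mem_origin_auts)
  have "hamming_dist (inv' f x) (inv' f y) = hamming_dist x y" for x y
    using iso[of "inv' f x" "inv' f y"] f(1) by (simp add: bij_is_surj surj_f_inv_f)
  moreover have "inv' f ` D_minus = D_minus"
    by (metis f(1,2) bij_is_inj image_inv_f_f)
  moreover have "inv' f 0 = 0" by (metis f(1,3) bij_is_inj inv_f_f)
  ultimately show ?thesis using f(1) by (simp add: mem_origin_auts bij_imp_bij_inv)
qed

lemma weight1_action_comp:
  assumes "f \<in> origin_auts" "g \<in> origin_auts"
  shows "weight1_action (f \<circ> g) = weight1_action f \<circ> weight1_action g"
proof -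
  obtain p s q t where f: "acts_by p s f" and g: "acts_by q t g"
    using assms by (meson origin_auts_acts_by)
  show ?thesis
  proof (rule weight1_action_eqI)
    fix k :: nat assume "k \<in> {1..33}"
    then have k: "weight1_action g k \<in> {1..33}" "g (weight1_vector k) = weight1_vector (weight1_action g k)"
      using weight1_action[OF g] by blast+
    then show "(weight1_action f \<circ> weight1_action g) k \<in> {1..33} \<and>
        (f \<circ> g) (weight1_vector k) = weight1_vector ((weight1_action f \<circ> weight1_action g) k)"
      using weight1_action(1,2)[OF f k(1)] by simp
  qed (simp only: weight1_action_def comp_apply if_False)
qed

lemma weight1_action_id: "weight1_action id = id"
  by (rule weight1_action_eqI) auto

lemma weight1_action_inv:
  assumes "f \<in> origin_auts"
  shows "weight1_action f \<circ> weight1_action (inv' f) = id" "weight1_action (inv' f) \<circ> weight1_action f = id"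
proof -
  have "f \<circ> inv' f = id" "inv' f \<circ> f = id"
    using assms by (auto simp: mem_origin_auts fun_eq_iff bij_is_surj surj_f_inv_f bij_is_inj)
  then show "weight1_action f \<circ> weight1_action (inv' f) = id"
    "weight1_action (inv' f) \<circ> weight1_action f = id"
    using assms origin_auts_inv[OF assms]
    by (metis weight1_action_comp weight1_action_id)+
qed

lemma weight1_action_permutes:
  assumes "f \<in> origin_auts"
  shows "weight1_action f permutes {1..33}"
proof (rule bij_imp_permutes)
  obtain p s q t where "acts_by p s f" "acts_by q t (inv' f)"
    using assms origin_auts_inv by (meson origin_auts_acts_by)
  then show "bij_betw (weight1_action f) {1..33} {1..33}"
    using weight1_action_inv[OF assms, unfolded fun_eq_iff]
    by (intro bij_betw_byWitness[of _ "weight1_action (inv' f)"] image_subsetI weight1_action(1)) simp_all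
qed (simp only: weight1_action_def if_False)

text \<open>Number 1 is the first unit vector and number 10 lies at position 3. Only the position of
  the image of 10 is prescribed, not its symbol.\<close>

lemma origin_auts_rigid_weight1:
  assumes f: "f \<in> origin_auts"
    and fixed: "weight1_action f 1 = 1" "(weight1_action f 10 - 1) div 3 = 3"
  shows "f = id"
proof -
  obtain p s where ps: "acts_by p s f" using f by (rule origin_auts_acts_by)
  have "p 0 = 0" "p 3 = 3"
    using weight1_action(3)[OF ps, of 1] weight1_action(3)[OF ps, of 10] fixed by simp_all
  moreover have "axis (coord 0) (s 0 1) = axis (coord 0) (1 :: gf4)"
    using weight1_action(2)[OF ps, of 1] acts_by_axis[OF ps, of 0 1] fixed \<open>p 0 = 0\<close>
    by (simp add: weight1_vector_eq_axis)
  then have "s 0 1 = 1" using axis_eq_axisD(2)[of _ "1 :: gf4"] by (metis zero_neq_one)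
  ultimately show ?thesis using origin_auts_rigid[OF ps f] by (simp add: one_gf4_def)
qed

section \<open>The two generators as permutations of 33 points\<close>

definition gmap :: "bool \<Rightarrow> gf4 ^ 11 \<Rightarrow> gf4 ^ 11" where
  "gmap b = (if b then monomial_map perm1 scal1 else monomial_map perm2 scal2)"

definition gperm :: "bool \<Rightarrow> nat \<Rightarrow> nat" where
  "gperm b = (if b then gen1 else gen2)"

text \<open>The values at 1 to 33, stored from index 0, so that evaluation uses list lookups instead
  of products of cycles.\<close>

definition gperm_table :: "bool \<Rightarrow> nat list" where
  "gperm_table b =
     (if b then [4, 5, 6, 27, 25, 26, 9, 7, 8, 22, 23, 24, 17, 18, 16, 2, 3, 1, 31, 32, 33,
                 12, 10, 11, 30, 28, 29, 13, 14, 15, 20, 21, 19]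
      else [1, 2, 3, 32, 33, 31, 17, 18, 16, 23, 24, 22, 27, 25, 26, 9, 7, 8, 28, 29, 30,
            12, 10, 11, 14, 15, 13, 19, 20, 21, 6, 4, 5])"

lemma transpose_apply: "Transposition.transpose a b c = (if c = a then b else if c = b then a else c)"
  by (simp add: Transposition.transpose_def)

lemma map_gperm: "map (gperm b) [1..<34] = gperm_table b"
  by (cases b) (simp_all add: gperm_def gperm_table_def gen1_def gen2_def transpose_apply upt_rec)

lemma gperm_nth:
  assumes "k \<in> {1..33}"
  shows "gperm b k = gperm_table b ! (k - 1)"
proof -
  have "map (gperm b) [1..<34] ! (k - 1) = gperm b k"
    using assms by (subst nth_map) (auto simp del: upt_rec_numeral)
  then show ?thesis by (simp only: map_gperm)
qed

lemma gperm_outside: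
  assumes "k \<notin> {1..33}"
  shows "gperm b k = k"
proof -
  have "k = 0 \<or> 33 < k" using assms by auto
  then show ?thesis
    by (cases b) (elim disjE; simp add: gperm_def gen1_def gen2_def id_outside_supp
        del: cycle_of_list.simps)+
qed

definition unit_word :: "nat \<Rightarrow> word" where
  "unit_word k = zero_word[(k - 1) div 3 := [1, \<omega>, \<omega>\<^sup>2] ! ((k - 1) mod 3)]"

lemma entries_weight1_vector:
  assumes "k \<in> {1..33}"
  shows "entries (weight1_vector k) = unit_word k"
proof (rule nth_equalityI)
  have "(k - 1) div 3 < 11" using assms by auto
  then show "entries (weight1_vector k) ! j = unit_word k ! j"
    if "j < length (entries (weight1_vector k))" for j
    using that by (auto simp: unit_word_def weight1_vector_eq_axis axis_def nth_list_update)
qed (simp add: unit_word_def)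

lemma gperm_table_correct:
  "list_all (\<lambda>(b, P, A). list_all (\<lambda>k. gperm_table b ! (k - 1) \<in> set [1..<34] \<and>
       monomial_word P A (unit_word k) = unit_word (gperm_table b ! (k - 1))) [1..<34])
     [(True, perm1, scal1), (False, perm2, scal2)]"
  by code_simp

lemma gmap_weight1_vector:
  assumes "k \<in> {1..33}"
  shows "gperm b k \<in> {1..33}" "gmap b (weight1_vector k) = weight1_vector (gperm b k)"
proof -
  define P where "P = (if b then perm1 else perm2)"
  define A where "A = (if b then scal1 else scal2)"
  have gmap: "gmap b = monomial_map P A" and "(P, A) \<in> set generator_data"
    and mem: "(b, P, A) \<in> set [(True, perm1, scal1), (False, perm2, scal2)]"
    by (simp_all add: gmap_def P_def A_def generator_data_def)
  have k: "k \<in> set [1..<34]" using assms by auto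
  have *: "gperm b k \<in> set [1..<34]" "monomial_word P A (unit_word k) = unit_word (gperm b k)"
    using bspec[OF gperm_table_correct[unfolded list_all_iff] mem] k
    by (auto simp: gperm_nth[OF assms])
  then show gk: "gperm b k \<in> {1..33}" by auto
  have "entries (gmap b (weight1_vector k)) = entries (weight1_vector (gperm b k))"
    using *(2) generator_data_wf[OF \<open>(P, A) \<in> set generator_data\<close>]
    by (simp add: gmap entries_monomial_map entries_weight1_vector[OF assms] entries_weight1_vector[OF gk])
  then show "gmap b (weight1_vector k) = weight1_vector (gperm b k)" by simp
qed

text \<open>Ties the monomial data \<open>perm1\<close>, \<open>scal1\<close>, \<open>perm2\<close>,
  \<open>scal2\<close> to the cycles of \<open>gen1\<close> and \<open>gen2\<close>.\<close>

lemma weight1_action_gmap: "weight1_action (gmap b) = gperm b"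
  using gmap_weight1_vector gperm_outside by (intro weight1_action_eqI) auto

section \<open>The automorphism groups\<close>

lemma mem_monomial_aut_group:
  "f \<in> carrier (monomial_aut_group D_minus) \<longleftrightarrow> monomial f \<and> f ` D_minus = D_minus"
  by (simp add: monomial_aut_group_def)

lemma monomial_aut_group_subset_origin_auts: "carrier (monomial_aut_group D_minus) \<subseteq> origin_auts"
proof
  fix f assume "f \<in> carrier (monomial_aut_group D_minus)"
  then have f: "monomial f" "f ` D_minus = D_minus" by (simp_all add: mem_monomial_aut_group)
  moreover have "f 0 = 0" using f(1) by (auto simp: monomial_def vec_eq_iff)
  ultimately show "f \<in> origin_auts"
    using monomial_imp_isometry[OF f(1)] by (auto simp: mem_origin_auts carrier_hamming_isometry_group)
qed

section \<open>Products of the generators\<close>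

lemma monomial_id: "monomial id"
  unfolding monomial_def by (intro exI[of _ id] exI[of _ "\<lambda>i. 1"]) (auto simp: vec_eq_iff)

lemma monomial_comp:
  assumes "monomial f" "monomial g"
  shows "monomial (f \<circ> g)"
proof -
  obtain \<pi> a where f: "bij \<pi>" "\<forall>i. a i \<noteq> 0" "f = (\<lambda>x. \<chi> i. a i * x $ \<pi> i)"
    using assms(1) by (auto simp: monomial_def)
  obtain \<rho> b where g: "bij \<rho>" "\<forall>i. b i \<noteq> 0" "g = (\<lambda>x. \<chi> i. b i * x $ \<rho> i)"
    using assms(2) by (auto simp: monomial_def)
  show ?thesis
    unfolding monomial_def using f g
    by (intro exI[of _ "\<rho> \<circ> \<pi>"] exI[of _ "\<lambda>i. a i * b (\<pi> i)"]) (auto simp: bij_comp vec_eq_iff mult.assoc)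
qed

text \<open>Lists of booleans are words in the generators, \<open>True\<close> naming the first one;
  the last letter acts first.\<close>

fun word_map :: "bool list \<Rightarrow> gf4 ^ 11 \<Rightarrow> gf4 ^ 11" where
  "word_map [] = id"
| "word_map (b # bs) = gmap b \<circ> word_map bs"

fun word_perm :: "bool list \<Rightarrow> nat \<Rightarrow> nat" where
  "word_perm [] k = k"
| "word_perm (b # bs) k = gperm_table b ! (word_perm bs k - 1)"

lemma gmap_mem: "gmap b \<in> carrier (monomial_aut_group D_minus)"
  using monomial_map_D_minus by (simp add: mem_monomial_aut_group gmap_def generator_data_def)

lemma word_map_mem: "word_map bs \<in> carrier (monomial_aut_group D_minus)"
proof (induction bs)
  case Nil
  show ?case
    unfolding word_map.simps mem_monomial_aut_group using monomial_id by (metis image_id id_apply)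
next
  case (Cons b bs)
  then show ?case
    using gmap_mem[of b] unfolding word_map.simps mem_monomial_aut_group
    by (metis monomial_comp image_comp)
qed

lemma word_map_origin: "word_map bs \<in> origin_auts"
  using word_map_mem monomial_aut_group_subset_origin_auts by blast

lemma gmap_origin: "gmap b \<in> origin_auts"
  using gmap_mem monomial_aut_group_subset_origin_auts by blast

lemma weight1_action_word_map:
  "weight1_action (word_map (b # bs)) = gperm b \<circ> weight1_action (word_map bs)"
  by (simp add: weight1_action_comp gmap_origin word_map_origin weight1_action_gmap)

lemma weight1_action_word_perm:
  assumes "k \<in> {1..33}"
  shows "weight1_action (word_map bs) k = word_perm bs k"
proof (induction bs)
  case Nil
  show ?case unfolding word_map.simps weight1_action_id by simp
next
  case (Cons b bs)
  obtain p s where "acts_by p s (word_map bs)" using word_map_origin by (rule origin_auts_acts_by)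
  then have "weight1_action (word_map bs) k \<in> {1..33}" using assms by (rule weight1_action(1))
  then show ?case using Cons gperm_nth by (simp add: weight1_action_word_map del: word_map.simps)
qed

text \<open>The powers of the first generator times representatives of the nine cosets of the group it generates.\<close>

definition transversal :: "bool list list" where
  "transversal = concat (map (\<lambda>i. map (\<lambda>r. replicate i True @ r)
     [[], [False], [False, True], [False, True, True], [False, True, False],
      [False, True, True, False], [False, True, False, True],
      [False, True, True, False, True], [False, True, False, True, True]]) [0..<6])"

text \<open>Number 10 is a vector on coordinate 4, so the second component is the position to which coordinate 4 moves.\<close>

definition base_image :: "bool list \<Rightarrow> nat \<times> nat" where
  "base_image bs = (word_perm bs 1, (word_perm bs 10 - 1) div 3)"

lemma length_transversal: "length transversal = 54"
  by code_simp

lemma distinct_base_images: "distinct (map base_image transversal)"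
  by code_simp

text \<open>Numbers in the blocks of positions 3 and 7 are not possible images of 1. Each of the
  other 27 must occur together with both possible images of position 3.\<close>

definition exhaustive :: "(nat \<times> nat) list \<Rightarrow> bool" where
  "exhaustive ks \<longleftrightarrow>
     list_all (\<lambda>k. (k - 1) div 3 \<in> {3, 7} \<or> (k, 3) \<in> set ks \<and> (k, 7) \<in> set ks) [1..<34]"

lemma base_images_exhaustive: "exhaustive (map base_image transversal)"
  by code_simp

text \<open>Some listed product \<open>g\<close> has the same base image as \<open>f\<close>. Then
  \<open>inv' g \<circ> f\<close> fixes the base, and rigidity makes it the identity.\<close>

lemma origin_auts_eq: "origin_auts = word_map ` set transversal"
proof (intro equalityI subsetI)
  fix f assume f: "f \<in> origin_auts"
  then obtain p s where ps: "acts_by p s f" by (rule origin_auts_acts_by)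
  define k where "k = weight1_action f 1"
  define c where "c = (weight1_action f 10 - 1) div 3"
  have k: "k \<in> set [1..<34]" using weight1_action(1)[OF ps, of 1] by (auto simp: k_def)
  have "(k - 1) div 3 \<notin> {3, 7}" "c \<in> {3, 7}"
    using origin_auts_coords[OF ps f] weight1_action(3)[OF ps, of 1] weight1_action(3)[OF ps, of 10]
    by (simp_all add: k_def c_def)
  then have "(k, c) \<in> set (map base_image transversal)"
    using base_images_exhaustive k unfolding exhaustive_def list_all_iff by blast
  then obtain bs where bs: "bs \<in> set transversal" "base_image bs = (k, c)" by auto
  define g where "g = word_map bs"
  have g: "g \<in> origin_auts" by (simp add: g_def word_map_origin)
  have gk: "weight1_action g 1 = k" and gc: "(weight1_action g 10 - 1) div 3 = c"
    using bs(2) by (simp_all add: g_def weight1_action_word_perm base_image_def)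
  note inv = origin_auts_inv[OF g]
  obtain q t where qt: "acts_by q t (inv' g)" using inv by (rule origin_auts_acts_by)
  obtain q' t' where qt': "acts_by q' t' g" using g by (rule origin_auts_acts_by)
  have can: "weight1_action (inv' g) (weight1_action g j) = j" for j
    using weight1_action_inv(2)[OF g] by (simp add: fun_eq_iff)
  have comp: "weight1_action (inv' g \<circ> f) j = weight1_action (inv' g) (weight1_action f j)" for j
    by (simp add: weight1_action_comp[OF inv f])
  have "weight1_action (inv' g \<circ> f) 1 = 1"
    using can[of 1] gk by (simp add: comp k_def)
  moreover have "(weight1_action (inv' g \<circ> f) 10 - 1) div 3 = 3"
  proof -
    \<comment> \<open>The images of 10 under \<open>f\<close> and \<open>g\<close> share only the
      position \<open>c\<close>. This suffices, since \<open>inv' g\<close> acts on positions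
      through \<open>q\<close>.\<close>
    have "(weight1_action (inv' g \<circ> f) 10 - 1) div 3 = q c"
      using weight1_action(3)[OF qt weight1_action(1)[OF ps, of 10]] by (simp add: comp c_def)
    also have "\<dots> = (weight1_action (inv' g) (weight1_action g 10) - 1) div 3"
      using weight1_action(3)[OF qt weight1_action(1)[OF qt', of 10]] gc by simp
    finally show ?thesis by (simp add: can)
  qed
  ultimately have "inv' g \<circ> f = id"
    using origin_auts_rigid_weight1 origin_auts_comp[OF inv f] by blast
  moreover have "surj g" using g by (simp add: mem_origin_auts bij_def)
  ultimately have "f = g" by (metis comp_apply fun_eq_iff id_apply surj_f_inv_f)
  then show "f \<in> word_map ` set transversal" using bs(1) g_def by blast
qed (use word_map_origin in auto)

text \<open>The listed products are monomial and exhaust the automorphisms fixing the origin, so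
  none of these changes symbols other than by scalars.\<close>

lemma monomial_aut_group_eq: "carrier (monomial_aut_group D_minus) = origin_auts"
  using monomial_aut_group_subset_origin_auts word_map_mem by (auto simp: origin_auts_eq)

text \<open>A map determines its base image, so the 54 distinct base images belong to 54 distinct
  maps.\<close>

lemma card_origin_auts: "card origin_auts = 54"
proof -
  have "base_image bs = base_image bs'" if "word_map bs = word_map bs'" for bs bs'
    using weight1_action_word_perm[of _ bs] weight1_action_word_perm[of _ bs'] that
    by (simp add: base_image_def)
  then have "inj_on word_map (set transversal)"
    using distinct_base_images unfolding distinct_map by (meson inj_on_def)
  moreover have "card (set transversal) = 54"
    using distinct_base_images length_transversal by (simp add: distinct_card distinct_map)
  ultimately show ?thesis by (simp add: origin_auts_eq card_image)
qed

text \<open>One inclusion writes every automorphism as a word in the generators; for the other, the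
  image of the action is closed under products and inverses.\<close>

lemma weight1_action_origin_auts:
  "weight1_action ` origin_auts = generate (sym_group 33) {gen1, gen2}"
proof (intro equalityI subsetI)
  have gens: "{gen1, gen2} = range gperm" by (auto simp: gperm_def UNIV_bool)
  have "weight1_action (word_map bs) \<in> generate (sym_group 33) {gen1, gen2}" for bs
  proof (induction bs)
    case Nil
    show ?case
      using generate.one[of "sym_group 33" "{gen1, gen2}"]
      unfolding word_map.simps weight1_action_id sym_group_one .
  next
    case (Cons b bs)
    have "gperm b \<in> generate (sym_group 33) {gen1, gen2}"
      by (intro generate.incl) (simp add: gens)
    from generate.eng[OF this Cons] show ?case
      by (simp only: weight1_action_word_map sym_group_mult)
  qed
  then show "\<sigma> \<in> generate (sym_group 33) {gen1, gen2}" if "\<sigma> \<in> weight1_action ` origin_auts" for \<sigma>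
    using that by (auto simp: origin_auts_eq)
  fix \<sigma> assume "\<sigma> \<in> generate (sym_group 33) {gen1, gen2}"
  then show "\<sigma> \<in> weight1_action ` origin_auts"
  proof induction
    case one
    show ?case unfolding sym_group_one using id_mem_origin_auts weight1_action_id by (metis imageI)
  next
    case (incl h)
    then obtain b where "h = weight1_action (gmap b)" using weight1_action_gmap by (auto simp: gens)
    then show ?case using gmap_origin by blast
  next
    case (inv h)
    then obtain b where h: "h = weight1_action (gmap b)" using weight1_action_gmap by (auto simp: gens)
    \<comment> \<open>Membership in the carrier identifies the group inverse with the inverse
      function.\<close>
    have "h \<in> carrier (sym_group 33)"
      using weight1_action_permutes[OF gmap_origin] by (simp add: h sym_group_carrier)
    then have "inv\<^bsub>sym_group 33\<^esub> h = inv' h" by simp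
    also have "inv' h = weight1_action (inv' (gmap b))"
      using weight1_action_inv[OF gmap_origin[of b]] by (simp add: h inv_unique_comp)
    finally show ?case using origin_auts_inv[OF gmap_origin] by simp
  next
    case (eng h1 h2)
    then obtain f g where "f \<in> origin_auts" "g \<in> origin_auts"
      "h1 = weight1_action f" "h2 = weight1_action g"
      by blast
    then show ?case
      by (metis imageI origin_auts_comp sym_group_mult weight1_action_comp)
  qed
qed

section \<open>Translations and the complete automorphism group\<close>

lemma origin_auts_add: "g \<in> origin_auts \<Longrightarrow> g (x + y) = g x + g y"
  by (meson acts_by_add origin_auts_acts_by)

lemma mem_complete_aut_group:
  "f \<in> carrier (complete_aut_group D_minus) \<longleftrightarrow>
     bij f \<and> (\<forall>x y. hamming_dist (f x) (f y) = hamming_dist x y) \<and> f ` D_minus = D_minus"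
  by (simp add: complete_aut_group_def carrier_hamming_isometry_group)

lemma hamming_dist_add_right: "hamming_dist (x + c) (y + c) = hamming_dist x (y :: 'a::field ^ 'n)"
  by (simp add: hamming_dist_def)

lemma bij_add_right: "bij (\<lambda>x. x + (c :: gf4 ^ 'n))"
  by (rule o_bij[of "\<lambda>x. x + c"]) (auto simp: add.assoc)

lemma translate_D_minus: "c \<in> D_minus \<Longrightarrow> (\<lambda>x. x + c) ` D_minus = D_minus"
  using bij_add_right[of c] D_minus_add
  by (intro endo_inj_surj) (auto simp: bij_def intro: inj_on_subset)

text \<open>Undoing the displacement of the origin leaves an automorphism \<open>g\<close> that
  fixes it; additivity of \<open>g\<close> then moves the translation to the inner side.\<close>

lemma complete_aut_group_eq:
  "carrier (complete_aut_group D_minus) = (\<lambda>(g, c). g \<circ> (\<lambda>x. x + c)) ` (origin_auts \<times> D_minus)"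
proof (intro equalityI subsetI)
  fix f assume "f \<in> carrier (complete_aut_group D_minus)"
  then have f: "bij f" "\<And>x y. hamming_dist (f x) (f y) = hamming_dist x y" "f ` D_minus = D_minus"
    by (simp_all add: mem_complete_aut_group)
  \<comment> \<open>Adding \<open>f 0\<close> subtracts it, the characteristic being 2.\<close>
  define g where "g = (\<lambda>x. x + f 0) \<circ> f"
  have f0: "f 0 \<in> D_minus" using f(3) zero_mem_D_minus by blast
  have "g ` D_minus = D_minus"
    using f(3) translate_D_minus[OF f0] unfolding g_def by (metis image_comp)
  moreover have "bij g" unfolding g_def using f(1) bij_add_right by (rule bij_comp)
  ultimately have g: "g \<in> origin_auts"
    using f(2) by (simp add: mem_origin_auts g_def hamming_dist_add_right)
  \<comment> \<open>Chosen with \<open>g c = f 0\<close>, so that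
    \<open>g (x + c) = g x + f 0 = f x\<close>.\<close>
  define c where "c = inv' g (f 0)"
  have c: "g c = f 0" using g by (simp add: c_def mem_origin_auts bij_is_surj surj_f_inv_f)
  have "c \<in> D_minus"
    using origin_auts_inv[OF g] f0 by (auto simp: c_def mem_origin_auts)
  moreover have "f x = g (x + c)" for x
  proof -
    have "g (x + c) = g x + f 0" by (simp only: origin_auts_add[OF g] c)
    then show ?thesis by (simp only: g_def comp_apply add.assoc gf4_vec_add_self add_0_right)
  qed
  then have "f = g \<circ> (\<lambda>x. x + c)" by (simp add: fun_eq_iff)
  ultimately show "f \<in> (\<lambda>(g, c). g \<circ> (\<lambda>x. x + c)) ` (origin_auts \<times> D_minus)"
    using g by auto
next
  fix f assume "f \<in> (\<lambda>(g, c). g \<circ> (\<lambda>x. x + c)) ` (origin_auts \<times> D_minus)"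
  then obtain g c where g: "g \<in> origin_auts" and c: "c \<in> D_minus" and f: "f = g \<circ> (\<lambda>x. x + c)"
    by auto
  have "f ` D_minus = D_minus"
    using g translate_D_minus[OF c] unfolding f mem_origin_auts by (metis image_comp)
  moreover have "bij f" using g bij_add_right bij_comp unfolding f mem_origin_auts by blast
  ultimately show "f \<in> carrier (complete_aut_group D_minus)"
    using g by (simp add: mem_complete_aut_group mem_origin_auts f hamming_dist_add_right)
qed

text \<open>Uniqueness of the factorisation, from which the order follows: the value at 0 gives
  \<open>g c = h d\<close>, hence \<open>g = h\<close> and then \<open>c = d\<close>.\<close>

lemma inj_on_complete_aut_group:
  "inj_on (\<lambda>(g, c). g \<circ> (\<lambda>x. x + c)) (origin_auts \<times> D_minus)"
proof (rule inj_onI, clarify)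
  fix g h c d
  assume g: "g \<in> origin_auts" and h: "h \<in> origin_auts" and "g \<circ> (\<lambda>x. x + c) = h \<circ> (\<lambda>x. x + d)"
  then have eq: "g x + g c = h x + h d" for x
    by (simp add: fun_eq_iff flip: origin_auts_add)
  have 0: "g 0 = 0" "h 0 = 0" using g h by (simp_all add: mem_origin_auts)
  have "g c = h d" using eq[of 0] 0 by simp
  moreover from this have "g = h" using eq by (simp add: fun_eq_iff)
  moreover have "inj h" using h by (simp add: mem_origin_auts bij_def)
  ultimately show "g = h \<and> c = d" by (simp add: inj_eq)
qed

theorem theorem3:
  shows "order (monomial_aut_group D_minus) = 54 \<and>
    weight1_action ` carrier (monomial_aut_group D_minus) = generate (sym_group 33) {gen1, gen2} \<and>
    carrier (complete_aut_group D_minus) =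
      carrier (monomial_aut_group D_minus) <#>\<^bsub>hamming_isometry_group\<^esub>
      carrier (translation_group D_minus) \<and>
    order (complete_aut_group D_minus) = 54 * 2 ^ 12"
proof (intro conjI)
  show "order (monomial_aut_group D_minus) = 54"
    by (simp add: order_def monomial_aut_group_eq card_origin_auts)
  show "weight1_action ` carrier (monomial_aut_group D_minus) = generate (sym_group 33) {gen1, gen2}"
    by (simp add: monomial_aut_group_eq weight1_action_origin_auts)
  \<comment> \<open>The product of the isometry group is known to be composition for bijections,
    which both factors are.\<close>
  have "g \<otimes>\<^bsub>hamming_isometry_group\<^esub> (\<lambda>x. x + c) = g \<circ> (\<lambda>x. x + c)" if "g \<in> origin_auts" for g c
    using that by (intro mult_hamming_isometry_group bij_add_right) (simp add: mem_origin_auts)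
  then show "carrier (complete_aut_group D_minus) =
      carrier (monomial_aut_group D_minus) <#>\<^bsub>hamming_isometry_group\<^esub>
      carrier (translation_group D_minus)"
    by (fastforce simp: complete_aut_group_eq monomial_aut_group_eq translation_group_def set_mult_def)
  show "order (complete_aut_group D_minus) = 54 * 2 ^ 12"
    by (simp add: order_def complete_aut_group_eq card_image inj_on_complete_aut_group
        card_cartesian_product card_origin_auts card_D_minus)
qed

end
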